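(* As $n\to\infty$, $$T_{k,n}=\sqrt n\,(\widehat\rho_{k,n}-\rho_k)\ \overset{d}{\longrightarrow}\ W_{I_{\rho_k}}:=\min_{j\in I_{\rho_k}}Z_j ,$$ where $(Z_j)_{j\in\mathcal S_k}$ is a random vector with law $\mathcal N(0,\Sigma_k)$ and $$(\Sigma_k)_{r,s}=\operatorname{Cov}\big[\nabla^k\mathbf 1_{\{X_1=m+r-1\}},\nabla^k\mathbf 1_{\{X_1=m+s-1\}}\big],\qquad r,s\in\{1,\dots,M-k-m+1\}$$ (the $r$-th coordinate of the vector corresponds to the index $j=m+r-1\in\mathcal S_k$). In particular, if $\rho_k=0$, then $p$ is $k$-monotone and $I_0=\mathcal S_k\setminus J_0$, where $J_0=\{j\in\mathcal S_k:\nabla^kp(j)>0\}$ is the set of knots of $p$.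
   Context: Let $k\in\mathbb N_0$, let $m\le M-k$ be integers, $\mathcal S=\{m,\dots,M\}$, $\mathcal S_k=\{m,\dots,M-k\}$, and let $p$ be a probability mass function (p.m.f.) on $\mathbb Z$ with support $\mathcal S$ (i.e. $p(j)>0$ iff $j\in\mathcal S$). For a real function $q$ of an integer variable, $\nabla^kq(j)=(-1)^k\Delta^kq(j)$, where $\Delta^0q(j)=q(j)$, $\Delta^1q(j)=q(j+1)-q(j)$, $\Delta^rq(j)=\Delta^1[\Delta^{r-1}q](j)$ for $r\ge2$. The notation $\nabla^k\mathbf 1_{\{X=j\}}$ means $\nabla^k$ applied to the function $j\mapsto\mathbf 1_{\{X=j\}}$, evaluated at $j$. The p.m.f. $p$ is called $k$-monotone if $\nabla^kp(j)\ge0$ for all $j\in\mathcal S_k$; $j\in\mathcal S_k$ is a knot of $p$ if $\nabla^kp(j)>0$. Put $\rho_k=\min_{j\in\mathcal S_k}\nabla^kp(j)$ and, for $h\in\mathbb R$, $I_h=\{j\in\mathcal S_k:\nabla^kp(j)=h\}$. Let $X_1,X_2,\dots$ be i.i.d. with p.m.f. $p$, $\widehat p_n(j)=\frac1n\sum_{i=1}^n\mathbf 1_{\{X_i=j\}}$, $X_{(1)}$ and $X_{(n)}$ the minimum and maximum of $X_1,\dots,X_n$, $\widehat{\mathcal S}_{k,n}=\{X_{(1)},\dots,X_{(n)}-k\}$ (all integers between the endpoints), and $\widehat\rho_{k,n}=\min_{j\in\widehat{\mathcal S}_{k,n}}\nabla^k\widehat p_n(j)$; if $\widehat{\mathcal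 S}_{k,n}$ is empty (an event of probability tending to $0$), set $\widehat\rho_{k,n}=0$. *)

theory Defs
  imports "HOL-Probability.Probability"
begin

definition fdiff :: "(int \<Rightarrow> real) \<Rightarrow> int \<Rightarrow> real" where
  "fdiff q j = q (j + 1) - q j"

definition nabla :: "nat \<Rightarrow> (int \<Rightarrow> real) \<Rightarrow> int \<Rightarrow> real" where
  "nabla k q j = (-1) ^ k * (fdiff ^^ k) q j"

(* In the following definitions m and M are the endpoints of the support {m..M} of q. *)

definition index_set :: "nat \<Rightarrow> int \<Rightarrow> int \<Rightarrow> int set" where
  "index_set k m M = {m..M - int k}"

definition k_monotone :: "nat \<Rightarrow> int \<Rightarrow> int \<Rightarrow> (int \<Rightarrow> real) \<Rightarrow> bool" where
  "k_monotone k m M q \<longleftrightarrow> (\<forall>j\<in>index_set k m M. nabla k q j \<ge> 0)"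

definition knots :: "nat \<Rightarrow> int \<Rightarrow> int \<Rightarrow> (int \<Rightarrow> real) \<Rightarrow> int set" where
  "knots k m M q = {j \<in> index_set k m M. nabla k q j > 0}"

definition min_nabla :: "nat \<Rightarrow> int \<Rightarrow> int \<Rightarrow> (int \<Rightarrow> real) \<Rightarrow> real" where
  "min_nabla k m M q = Min (nabla k q ` index_set k m M)"

definition level_set :: "nat \<Rightarrow> int \<Rightarrow> int \<Rightarrow> (int \<Rightarrow> real) \<Rightarrow> real \<Rightarrow> int set" where
  "level_set k m M q h = {j \<in> index_set k m M. nabla k q j = h}"

(* The sample is indexed from 1: the first n observations are X 1, ..., X n. *)

definition emp_pmf :: "(nat \<Rightarrow> 'a \<Rightarrow> int) \<Rightarrow> nat \<Rightarrow> 'a \<Rightarrow> int \<Rightarrow> real" where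
  "emp_pmf X n \<omega> j = (\<Sum>i=1..n. indicat_real {X i \<omega>} j) / real n"

definition emp_index_set :: "nat \<Rightarrow> (nat \<Rightarrow> 'a \<Rightarrow> int) \<Rightarrow> nat \<Rightarrow> 'a \<Rightarrow> int set" where
  "emp_index_set k X n \<omega> =
     {Min ((\<lambda>i. X i \<omega>) ` {1..n}) .. Max ((\<lambda>i. X i \<omega>) ` {1..n}) - int k}"

definition emp_min_nabla :: "nat \<Rightarrow> (nat \<Rightarrow> 'a \<Rightarrow> int) \<Rightarrow> nat \<Rightarrow> 'a \<Rightarrow> real" where
  "emp_min_nabla k X n \<omega> =
     (if emp_index_set k X n \<omega> = {} then 0
      else Min (nabla k (emp_pmf X n \<omega>) ` emp_index_set k X n \<omega>))"

definition covariance :: "'a measure \<Rightarrow> ('a \<Rightarrow> real) \<Rightarrow> ('a \<Rightarrow> real) \<Rightarrow> real" where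
  "covariance P U V =
     (LINT \<omega>|P. (U \<omega> - (LINT \<omega>'|P. U \<omega>')) * (V \<omega> - (LINT \<omega>'|P. V \<omega>')))"

(* Rows and columns are indexed by the integers of index_set k m M themselves
   rather than by their positions 1, ..., M - k - m + 1. *)

definition Sigma_nabla :: "'a measure \<Rightarrow> nat \<Rightarrow> ('a \<Rightarrow> int) \<Rightarrow> int \<Rightarrow> int \<Rightarrow> real" where
  "Sigma_nabla P k Y i j =
     covariance P (\<lambda>\<omega>. nabla k (indicat_real {Y \<omega>}) i) (\<lambda>\<omega>. nabla k (indicat_real {Y \<omega>}) j)"

(* The random vector (Z j), j in J, has law N(mu, S). The definition through the
   characteristic function covers singular S, which does occur here: for k = 0 the
   indicators of the points of the support add up to 1. *)

definition normal_vector ::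
    "'b measure \<Rightarrow> 'i set \<Rightarrow> ('i \<Rightarrow> 'b \<Rightarrow> real) \<Rightarrow> ('i \<Rightarrow> real) \<Rightarrow> ('i \<Rightarrow> 'i \<Rightarrow> real) \<Rightarrow> bool" where
  "normal_vector N J Z \<mu> S \<longleftrightarrow>
     finite J \<and> (\<forall>j\<in>J. Z j \<in> borel_measurable N) \<and>
     (\<forall>t :: 'i \<Rightarrow> real.
        (CLINT \<omega>|N. iexp (\<Sum>j\<in>J. t j * Z j \<omega>)) =
        exp (\<i> * complex_of_real (\<Sum>j\<in>J. t j * \<mu> j)
             - complex_of_real (\<Sum>i\<in>J. \<Sum>j\<in>J. t i * S i j * t j) / 2))"

end

(*
  The scaled fluctuations W_n(j) = sqrt n (nabla^k p_n(j) - nabla^k p(j)) are normalised sums of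
  bounded functions of X_i, so their joint characteristic function converges to the one of Z.
  Functions that are uniform limits of trigonometric sums form an algebra closed, by Weierstrass,
  under composition with continuous functions, hence under minima; with L arcsin(sin(w/L)) as a
  substitute for w, which agrees with w on [-L, L], and with tightness, min_{j in I} W_n(j)
  converges weakly to min_{j in I} Z_j.  For j outside I the deterministic drift
  sqrt n (nabla^k p(j) - rho) eventually exceeds every bound on the fluctuations, and with
  probability tending to 1 the sample contains both endpoints of the support; so T_{k,n} equals
  min_{j in I} W_n(j) with probability tending to 1.
*)

theory Submission
  imports Defs
begin

section \<open>Almost periodic functions of finitely many coordinates\<close>

text \<open>Convergence of joint characteristic functions gives convergence of the expectations of
  finite trigonometric sums, but a test function f(min w) is in general no uniform limit of such
  sums on all of R^J. Approximating it on a box alone would leave the trigonometric approximant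
  uncontrolled off the box. Folding the coordinates first yields a function approximable with one
  error bound for every w and still bounded by the sup of |f|; the only price is the probability of
  leaving the box. The joint characteristic functions themselves come from the one-dimensional
  central limit theorem for each fixed linear combination of the coordinates (Cramer-Wold).\<close>

inductive_set trig_sums :: "'i set \<Rightarrow> (('i \<Rightarrow> real) \<Rightarrow> complex) set" for J :: "'i set" where
  exp: "(\<lambda>w. c * iexp (\<Sum>j\<in>J. t j * w j)) \<in> trig_sums J"
| add: "F \<in> trig_sums J \<Longrightarrow> G \<in> trig_sums J \<Longrightarrow> (\<lambda>w. F w + G w) \<in> trig_sums J"

lemma trig_sums_const: "(\<lambda>w. c) \<in> trig_sums J"
  using trig_sums.exp[of c "\<lambda>_. 0" J] by simp

text \<open>Products of exponentials add the frequency vectors; with bilinearity this makes the sums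
  an algebra.\<close>

lemma trig_sums_mult_exp:
  assumes "F \<in> trig_sums J"
  shows "(\<lambda>w. c * iexp (\<Sum>j\<in>J. t j * w j) * F w) \<in> trig_sums J"
  using assms
proof induction
  case (exp d s)
  have "(\<lambda>w. c * iexp (\<Sum>j\<in>J. t j * w j) * (d * iexp (\<Sum>j\<in>J. s j * w j)))
      = (\<lambda>w. (c * d) * iexp (\<Sum>j\<in>J. (t j + s j) * w j))"
    by (simp add: distrib_right sum.distrib distrib_left exp_add mult_ac)
  then show ?case
    using trig_sums.exp[of "c * d" "\<lambda>j. t j + s j" J] by simp
next
  case (add F G)
  then show ?case
    by (simp only: distrib_left trig_sums.add)
qed

lemma trig_sums_mult:
  assumes "F \<in> trig_sums J" "G \<in> trig_sums J"
  shows "(\<lambda>w. F w * G w) \<in> trig_sums J"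
  using assms(1)
proof induction
  case (exp c t)
  show ?case using trig_sums_mult_exp[OF assms(2)] .
next
  case (add F F')
  then show ?case
    by (simp only: distrib_right trig_sums.add)
qed

lemma trig_sums_bounded:
  assumes "F \<in> trig_sums J"
  obtains B where "\<And>w. cmod (F w) \<le> B"
proof -
  have "\<exists>B. \<forall>w. cmod (F w) \<le> B"
    using assms
  proof induction
    case (exp c t)
    have "cmod (c * iexp (\<Sum>j\<in>J. t j * w j)) \<le> cmod c" for w :: "'a \<Rightarrow> real"
      unfolding norm_mult norm_exp_i_times by simp
    then show ?case by blast
  next
    case (add F G)
    then obtain B C where "\<And>w. cmod (F w) \<le> B" "\<And>w. cmod (G w) \<le> C" by blast
    then have "cmod (F w + G w) \<le> B + C" for w
      by (rule norm_triangle_mono)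
    then show ?case by blast
  qed
  then show thesis using that by blast
qed

text \<open>These are Bohr's almost periodic functions on R^J, taken as the uniform closure of the
  trigonometric polynomials. The functions are real, so that minima make sense, while the
  approximants stay complex. The error bound holds on the whole space and not just on compact sets,
  so one approximant serves all n at once.\<close>

definition almost_periodic :: "'i set \<Rightarrow> (('i \<Rightarrow> real) \<Rightarrow> real) \<Rightarrow> bool" where
  "almost_periodic J F \<longleftrightarrow>
     (\<forall>e>0. \<exists>T\<in>trig_sums J. \<forall>w. cmod (complex_of_real (F w) - T w) \<le> e)"

lemma almost_periodicD:
  assumes "almost_periodic J F" "e > 0"
  obtains T where "T \<in> trig_sums J" "\<And>w. cmod (complex_of_real (F w) - T w) \<le> e"
  using assms unfolding almost_periodic_def by blast

lemma almost_periodic_bounded: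
  assumes "almost_periodic J F"
  obtains B where "B > 0" "\<And>w. \<bar>F w\<bar> \<le> B"
proof -
  obtain T where T: "T \<in> trig_sums J" "\<And>w. cmod (complex_of_real (F w) - T w) \<le> 1"
    using almost_periodicD[OF assms, of 1] by auto
  obtain B where B: "\<And>w. cmod (T w) \<le> B" using trig_sums_bounded[OF T(1)] by blast
  have "\<bar>F w\<bar> \<le> \<bar>B\<bar> + 1" for w
    using norm_triangle_sub[of "complex_of_real (F w)" "T w"] T(2)[of w] B[of w] by simp
  then show thesis by (intro that[of "\<bar>B\<bar> + 1"]) auto
qed

lemma almost_periodic_const: "almost_periodic J (\<lambda>w. c)"
  unfolding almost_periodic_def
  by (intro allI impI bexI[OF _ trig_sums_const[of "complex_of_real c"]]) simp

lemma almost_periodic_add: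
  assumes "almost_periodic J F" "almost_periodic J G"
  shows "almost_periodic J (\<lambda>w. F w + G w)"
  unfolding almost_periodic_def
proof (intro allI impI)
  fix e :: real assume e: "e > 0"
  obtain S where S: "S \<in> trig_sums J" "\<And>w. cmod (complex_of_real (F w) - S w) \<le> e/2"
    using almost_periodicD[OF assms(1), of "e/2"] e by auto
  obtain T where T: "T \<in> trig_sums J" "\<And>w. cmod (complex_of_real (G w) - T w) \<le> e/2"
    using almost_periodicD[OF assms(2), of "e/2"] e by auto
  have "cmod (complex_of_real (F w + G w) - (S w + T w)) \<le> e" for w
    using norm_triangle_mono[OF S(2)[of w] T(2)[of w]] by (simp add: algebra_simps)
  then show "\<exists>T\<in>trig_sums J. \<forall>w. cmod (complex_of_real (F w + G w) - T w) \<le> e"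
    by (intro bexI[OF _ trig_sums.add[OF S(1) T(1)]]) blast
qed

lemma almost_periodic_mult:
  assumes "almost_periodic J F" "almost_periodic J G"
  shows "almost_periodic J (\<lambda>w. F w * G w)"
  unfolding almost_periodic_def
proof (intro allI impI)
  fix e :: real assume e: "e > 0"
  obtain A where A: "A > 0" "\<And>w. \<bar>F w\<bar> \<le> A" using almost_periodic_bounded[OF assms(1)] by blast
  obtain T where T: "T \<in> trig_sums J" "\<And>w. cmod (complex_of_real (G w) - T w) \<le> e / (2 * A)"
    using almost_periodicD[OF assms(2), of "e / (2 * A)"] e A(1) by auto
  obtain B where B: "\<And>w. cmod (T w) \<le> B" using trig_sums_bounded[OF T(1)] by blast
  \<comment> \<open>\<open>T\<close> is fixed before \<open>S\<close>, because the tolerance for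
    \<open>S\<close> depends on the bound of \<open>T\<close>. Adding 1 makes that bound a positive
    divisor.\<close>
  define C where "C = \<bar>B\<bar> + 1"
  have C: "C > 0" "\<And>w. cmod (T w) \<le> C" using B by (auto simp: C_def) (smt (verit) B)
  obtain S where S: "S \<in> trig_sums J" "\<And>w. cmod (complex_of_real (F w) - S w) \<le> e / (2 * C)"
    using almost_periodicD[OF assms(1), of "e / (2 * C)"] e C(1) by auto
  have "cmod (complex_of_real (F w * G w) - S w * T w) \<le> e" for w
  proof -
    have "complex_of_real (F w * G w) - S w * T w
        = complex_of_real (F w) * (complex_of_real (G w) - T w) + (complex_of_real (F w) - S w) * T w"
      by (simp add: algebra_simps)
    also have "cmod \<dots> \<le> A * (e / (2 * A)) + e / (2 * C) * C"
    proof (rule norm_triangle_mono)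
      show "cmod (complex_of_real (F w) * (complex_of_real (G w) - T w)) \<le> A * (e / (2 * A))"
        unfolding norm_mult norm_of_real using A T(2)[of w] by (intro mult_mono) auto
      show "cmod ((complex_of_real (F w) - S w) * T w) \<le> e / (2 * C) * C"
        unfolding norm_mult using C S(2)[of w] e by (intro mult_mono) auto
    qed
    also have "\<dots> = e" using A(1) C(1) by (simp add: field_simps)
    finally show ?thesis .
  qed
  then show "\<exists>T\<in>trig_sums J. \<forall>w. cmod (complex_of_real (F w * G w) - T w) \<le> e"
    by (intro bexI[OF _ trig_sums_mult[OF S(1) T(1)]]) blast
qed

lemma almost_periodic_polynomial:
  fixes q :: "real \<Rightarrow> real"
  assumes "real_polynomial_function q" and F: "almost_periodic J F"
  shows "almost_periodic J (\<lambda>w. q (F w))"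
  using assms(1)
proof induction
  case (linear f)
  then obtain c where "f = (\<lambda>x. x * c)" by (auto simp: real_bounded_linear)
  then show ?case using almost_periodic_mult[OF F almost_periodic_const] by simp
qed (simp_all add: almost_periodic_const almost_periodic_add almost_periodic_mult)

lemma almost_periodic_uniform_limit:
  assumes "\<And>e. e > 0 \<Longrightarrow> \<exists>G. almost_periodic J G \<and> (\<forall>w. \<bar>F w - G w\<bar> \<le> e)"
  shows "almost_periodic J F"
  unfolding almost_periodic_def
proof (intro allI impI)
  fix e :: real assume e: "e > 0"
  obtain G where G: "almost_periodic J G" "\<And>w. \<bar>F w - G w\<bar> \<le> e/2"
    using assms[of "e/2"] e by auto
  obtain T where T: "T \<in> trig_sums J" "\<And>w. cmod (complex_of_real (G w) - T w) \<le> e/2"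
    using almost_periodicD[OF G(1), of "e/2"] e by auto
  have "cmod (complex_of_real (F w) - T w) \<le> e" for w
  proof -
    have "cmod (complex_of_real (F w) - complex_of_real (G w)) \<le> e/2"
      using G(2)[of w] by (metis norm_of_real of_real_diff)
    from norm_triangle_mono[OF this T(2)[of w]] show ?thesis by simp
  qed
  then show "\<exists>T\<in>trig_sums J. \<forall>w. cmod (complex_of_real (F w) - T w) \<le> e"
    using T(1) by blast
qed

text \<open>Weierstrass approximation of \<open>h\<close> on the compact set \<open>S\<close>
  becomes uniform in all \<open>w\<close>, since \<open>F\<close> never leaves \<open>S\<close>. The
  set is a parameter because \<open>h\<close> may be continuous only there, as arcsin on
  [-1, 1].\<close>

lemma almost_periodic_compose:
  fixes h :: "real \<Rightarrow> real"
  assumes F: "almost_periodic J F" and S: "\<And>w. F w \<in> S" "compact S" and h: "continuous_on S h"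
  shows "almost_periodic J (\<lambda>w. h (F w))"
proof (rule almost_periodic_uniform_limit)
  fix e :: real assume "e > 0"
  then obtain q where q: "real_polynomial_function q" "\<And>x. x \<in> S \<Longrightarrow> \<bar>h x - q x\<bar> < e"
    using Stone_Weierstrass_real_polynomial_function[OF S(2) h] by blast
  then show "\<exists>G. almost_periodic J G \<and> (\<forall>w. \<bar>h (F w) - G w\<bar> \<le> e)"
    using almost_periodic_polynomial[OF q(1) F] S(1) by (metis less_imp_le)
qed

lemma almost_periodic_compose_continuous:
  fixes h :: "real \<Rightarrow> real"
  assumes F: "almost_periodic J F" and h: "continuous_on UNIV h"
  shows "almost_periodic J (\<lambda>w. h (F w))"
proof -
  obtain B where B: "\<And>w. \<bar>F w\<bar> \<le> B" using almost_periodic_bounded[OF F] by blast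
  show ?thesis
    by (rule almost_periodic_compose[OF F, of "{-B..B}"])
      (use B h in \<open>auto simp: abs_le_iff minus_le_iff intro: continuous_on_subset\<close>)
qed

text \<open>The identity min(a, b) = (a + b - |a - b|) / 2 reduces minima to sums and compositions
  with continuous functions.\<close>

lemma almost_periodic_min:
  assumes F: "almost_periodic J F" and G: "almost_periodic J G"
  shows "almost_periodic J (\<lambda>w. min (F w) (G w))"
proof -
  have neg: "almost_periodic J (\<lambda>w. - H w)" if "almost_periodic J H" for H
    by (rule almost_periodic_compose_continuous[OF that]) (intro continuous_intros)
  have "almost_periodic J (\<lambda>w. \<bar>F w + - G w\<bar>)"
    by (rule almost_periodic_compose_continuous[where h = abs])
      (intro almost_periodic_add F neg G continuous_intros)+
  then have "almost_periodic J (\<lambda>w. ((F w + G w) + - \<bar>F w + - G w\<bar>) * (1/2))"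
    by (intro almost_periodic_mult almost_periodic_add neg F G almost_periodic_const)
  also have "(\<lambda>w. ((F w + G w) + - \<bar>F w + - G w\<bar>) * (1/2)) = (\<lambda>w. min (F w) (G w))"
    by (auto simp: min_def)
  finally show ?thesis .
qed

lemma almost_periodic_Min:
  assumes "finite I" "I \<noteq> {}" "\<And>i. i \<in> I \<Longrightarrow> almost_periodic J (F i)"
  shows "almost_periodic J (\<lambda>w. Min ((\<lambda>i. F i w) ` I))"
  using assms
proof (induction I rule: finite_ne_induct)
  case (insert i I)
  then have "almost_periodic J (\<lambda>w. min (F i w) (Min ((\<lambda>i. F i w) ` I)))"
    by (intro almost_periodic_min) auto
  then show ?case using insert by simp
qed simp

lemma almost_periodic_sin:
  assumes "finite J" "j \<in> J"
  shows "almost_periodic J (\<lambda>w. sin (c * w j))"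
proof -
  have single: "(\<Sum>i\<in>J. (if i = j then c else 0) * w i) = c * w j" for c and w :: "'a \<Rightarrow> real"
  proof -
    have "(\<Sum>i\<in>J. (if i = j then c else 0) * w i) = (\<Sum>i\<in>J. if i = j then c * w i else 0)"
      by (intro sum.cong) auto
    then show ?thesis using assms by simp
  qed
  have e: "(\<lambda>w. a * iexp (c * w j)) \<in> trig_sums J" for a c
    using trig_sums.exp[of a "\<lambda>i. if i = j then c else 0" J] by (simp only: single)
  have "(\<lambda>w. (1 / (2 * \<i>)) * iexp (c * w j) + (- 1 / (2 * \<i>)) * iexp (- c * w j)) \<in> trig_sums J"
    using trig_sums.add[OF e e] .
  moreover have "(1 / (2 * \<i>)) * iexp (c * w j) + (- 1 / (2 * \<i>)) * iexp (- c * w j)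
      = complex_of_real (sin (c * w j))" for w :: "'a \<Rightarrow> real"
    unfolding sin_of_real[symmetric] sin_exp_eq by (simp add: field_simps)
  ultimately have "(\<lambda>w. complex_of_real (sin (c * w j))) \<in> trig_sums J"
    by simp
  then show ?thesis
    unfolding almost_periodic_def by (intro allI impI bexI) auto
qed

text \<open>On the box where \<open>\<bar>w j\<bar> \<le> L\<close> this almost periodic function is the coordinate \<open>w j\<close> itself.\<close>

lemma almost_periodic_fold:
  assumes "finite J" "j \<in> J"
  shows "almost_periodic J (\<lambda>w. L * arcsin (sin (w j / L)))"
proof -
  have "almost_periodic J (\<lambda>w. arcsin (sin (1 / L * w j)))"
    by (rule almost_periodic_compose[OF almost_periodic_sin[OF assms], of _ "{-1..1}"])
      (auto intro!: continuous_on_arcsin' continuous_intros)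
  then show ?thesis
    using almost_periodic_mult[OF almost_periodic_const[of J L]] by simp
qed

text \<open>arcsin inverts sin on [-pi/2, pi/2], and |x / L| is at most 1, hence at most pi/2; so
  the box can have half-width \<open>L\<close> without a factor pi.\<close>

lemma arcsin_sin_fold:
  assumes "L > 0" "\<bar>x\<bar> \<le> L"
  shows "L * arcsin (sin (x / L)) = x"
proof -
  have "\<bar>x / L\<bar> \<le> 1" using assms by simp
  then have "- (pi / 2) \<le> x / L" "x / L \<le> pi / 2"
    using pi_ge_two by linarith+
  then have "arcsin (sin (x / L)) = x / L"
    by (rule arcsin_sin)
  then show ?thesis using assms(1) by simp
qed

section \<open>Weak convergence of minima from joint characteristic functions\<close>

text \<open>Functions bounded by 1 differ by at most 2 on the exceptional set \<open>A\<close>. This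
  prices the exchange of a test function for its folded version.\<close>

lemma (in prob_space) expectation_diff_le_prob:
  fixes f g :: "'a \<Rightarrow> real"
  assumes [measurable]: "f \<in> borel_measurable M" "g \<in> borel_measurable M"
    and bnd: "\<And>x. \<bar>f x\<bar> \<le> 1" "\<And>x. \<bar>g x\<bar> \<le> 1"
    and A: "A \<in> events" and eq: "\<And>x. x \<in> space M \<Longrightarrow> x \<notin> A \<Longrightarrow> f x = g x"
  shows "\<bar>expectation f - expectation g\<bar> \<le> 2 * prob A"
proof -
  have int: "integrable M f" "integrable M g"
    using bnd by (auto intro!: integrable_const_bound[of _ 1])
  have "\<bar>expectation f - expectation g\<bar> = \<bar>expectation (\<lambda>x. f x - g x)\<bar>"
    using int by simp
  also have "\<dots> \<le> expectation (\<lambda>x. \<bar>f x - g x\<bar>)"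
    by (rule integral_abs_bound)
  also have "\<dots> \<le> expectation (\<lambda>x. 2 * indicator A x)"
  proof (rule integral_mono)
    show "integrable M (\<lambda>x. 2 * indicator A x :: real)"
      using A by (intro integrable_mult_right integrable_real_indicator) (auto simp: emeasure_eq_measure)
    show "\<bar>f x - g x\<bar> \<le> 2 * indicator A x" if "x \<in> space M" for x
      using eq[OF that] bnd[of x] by (auto simp: indicator_def)
  qed (use int in auto)
  also have "\<dots> = 2 * prob A" using A by simp
  finally show ?thesis .
qed

text \<open>The limit is described by its joint characteristic function alone; normality enters only
  when \<open>char_tendsto\<close> is verified. The two probability spaces are unrelated, since
  convergence in law compares distributions.\<close>

locale joint_char_convergence = P: prob_space P + N: prob_space N
  for P :: "'a measure" and N :: "'b measure" +
  fixes J :: "'i set" and W :: "nat \<Rightarrow> 'i \<Rightarrow> 'a \<Rightarrow> real" and Z :: "'i \<Rightarrow> 'b \<Rightarrow> real"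
  assumes finite_J: "finite J"
    and W_measurable: "\<And>n j. j \<in> J \<Longrightarrow> W n j \<in> borel_measurable P"
    and Z_measurable: "\<And>j. j \<in> J \<Longrightarrow> Z j \<in> borel_measurable N"
    and char_tendsto: "\<And>t :: 'i \<Rightarrow> real.
      (\<lambda>n. CLINT \<omega>|P. iexp (\<Sum>j\<in>J. t j * W n j \<omega>)) \<longlonglongrightarrow> (CLINT \<omega>|N. iexp (\<Sum>j\<in>J. t j * Z j \<omega>))"
begin

lemma trig_sums_integrable:
  assumes "T \<in> trig_sums J"
  shows "integrable P (\<lambda>\<omega>. T (\<lambda>j. W n j \<omega>))" "integrable N (\<lambda>\<omega>. T (\<lambda>j. Z j \<omega>))"
proof -
  obtain B where B: "\<And>w. cmod (T w) \<le> B" using trig_sums_bounded[OF assms] by blast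
  have "(\<lambda>\<omega>. T (\<lambda>j. W n j \<omega>)) \<in> borel_measurable P \<and> (\<lambda>\<omega>. T (\<lambda>j. Z j \<omega>)) \<in> borel_measurable N"
    using assms
  proof induction
    case (exp c t)
    have "(\<lambda>\<omega>. \<Sum>j\<in>J. t j * W n j \<omega>) \<in> borel_measurable P" "(\<lambda>\<omega>. \<Sum>j\<in>J. t j * Z j \<omega>) \<in> borel_measurable N"
      using W_measurable Z_measurable by (auto intro!: borel_measurable_sum)
    note this[measurable]
    show ?case by (intro conjI) measurable
  qed auto
  then show "integrable P (\<lambda>\<omega>. T (\<lambda>j. W n j \<omega>))" "integrable N (\<lambda>\<omega>. T (\<lambda>j. Z j \<omega>))"
    using B by (auto intro!: P.integrable_const_bound[of _ B] N.integrable_const_bound[of _ B])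
qed

lemma trig_sums_integral_tendsto:
  assumes "T \<in> trig_sums J"
  shows "(\<lambda>n. CLINT \<omega>|P. T (\<lambda>j. W n j \<omega>)) \<longlonglongrightarrow> (CLINT \<omega>|N. T (\<lambda>j. Z j \<omega>))"
  using assms
proof induction
  case (exp c t)
  show ?case
    unfolding integral_mult_right_zero by (intro tendsto_intros char_tendsto)
next
  case (add F G)
  then show ?case
    by (simp add: trig_sums_integrable tendsto_add)
qed

text \<open>The tolerance e/4 is spent three times: replacing \<open>F\<close> by \<open>T\<close>
  under \<open>P\<close>, passing to the limit for \<open>T\<close>, and replacing \<open>T\<close>
  by \<open>F\<close> under \<open>N\<close>. The first replacement is uniform in n because the
  approximation is uniform in w.\<close>

lemma almost_periodic_integral_tendsto:
  assumes F: "almost_periodic J F"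
    and [measurable]: "\<And>n. (\<lambda>\<omega>. F (\<lambda>j. W n j \<omega>)) \<in> borel_measurable P"
      "(\<lambda>\<omega>. F (\<lambda>j. Z j \<omega>)) \<in> borel_measurable N"
  shows "(\<lambda>n. LINT \<omega>|P. F (\<lambda>j. W n j \<omega>)) \<longlonglongrightarrow> (LINT \<omega>|N. F (\<lambda>j. Z j \<omega>))"
proof (rule LIMSEQ_I)
  fix e :: real assume e: "e > 0"
  obtain T where T: "T \<in> trig_sums J" "\<And>w. cmod (complex_of_real (F w) - T w) \<le> e/4"
    using almost_periodicD[OF F, of "e/4"] e by auto
  obtain B where B: "\<And>w. \<bar>F w\<bar> \<le> B" using almost_periodic_bounded[OF F] by blast
  have approx: "cmod (complex_of_real (LINT \<omega>|Q. F (V \<omega>)) - (CLINT \<omega>|Q. T (V \<omega>))) \<le> e/4"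
    if Q: "prob_space Q" and [measurable]: "(\<lambda>\<omega>. F (V \<omega>)) \<in> borel_measurable Q"
      and TV: "integrable Q (\<lambda>\<omega>. T (V \<omega>))"
    for Q :: "'c measure" and V
  proof -
    interpret Q: prob_space Q by fact
    have FV: "integrable Q (\<lambda>\<omega>. complex_of_real (F (V \<omega>)))"
      using B by (intro Q.integrable_const_bound[of _ B]) auto
    have "cmod (complex_of_real (LINT \<omega>|Q. F (V \<omega>)) - (CLINT \<omega>|Q. T (V \<omega>)))
        = cmod (CLINT \<omega>|Q. complex_of_real (F (V \<omega>)) - T (V \<omega>))"
      using FV TV by simp
    also have "\<dots> \<le> (LINT \<omega>|Q. cmod (complex_of_real (F (V \<omega>)) - T (V \<omega>)))"
      by (rule integral_norm_bound)
    also have "\<dots> \<le> (LINT \<omega>|Q. e/4)"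
      using FV TV T(2) by (intro integral_mono) auto
    finally show ?thesis by (simp add: Q.prob_space)
  qed
  obtain n0 where n0: "\<And>n. n \<ge> n0 \<Longrightarrow>
      cmod ((CLINT \<omega>|P. T (\<lambda>j. W n j \<omega>)) - (CLINT \<omega>|N. T (\<lambda>j. Z j \<omega>))) < e/4"
    using LIMSEQ_D[OF trig_sums_integral_tendsto[OF T(1)], of "e/4"] e by auto
  show "\<exists>n0. \<forall>n\<ge>n0. norm ((LINT \<omega>|P. F (\<lambda>j. W n j \<omega>)) - (LINT \<omega>|N. F (\<lambda>j. Z j \<omega>))) < e"
  proof (intro exI allI impI)
    fix n assume n: "n \<ge> n0"
    let ?f = "LINT \<omega>|P. F (\<lambda>j. W n j \<omega>)" and ?g = "LINT \<omega>|N. F (\<lambda>j. Z j \<omega>)"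
    let ?s = "CLINT \<omega>|P. T (\<lambda>j. W n j \<omega>)" and ?t = "CLINT \<omega>|N. T (\<lambda>j. Z j \<omega>)"
    have a: "cmod (complex_of_real ?f - ?s) \<le> e/4"
      by (intro approx P.prob_space_axioms trig_sums_integrable T(1) assms)
    have b: "cmod (complex_of_real ?g - ?t) \<le> e/4"
      by (intro approx N.prob_space_axioms trig_sums_integrable T(1) assms)
    have "complex_of_real (?f - ?g) = ((complex_of_real ?f - ?s) + (?s - ?t)) - (complex_of_real ?g - ?t)"
      by simp
    then have "norm (?f - ?g) = cmod (((complex_of_real ?f - ?s) + (?s - ?t)) - (complex_of_real ?g - ?t))"
      by (metis norm_of_real real_norm_def)
    also have "\<dots> \<le> (e/4 + e/4) + e/4"
      by (rule norm_triangle_le_diff, rule add_mono, rule norm_triangle_mono)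
        (use a b n0[OF n] in auto)
    also have "\<dots> < e" using e by simp
    finally show "norm (?f - ?g) < e" .
  qed
qed

text \<open>Marginals serve to obtain tightness. A frequency vector supported at \<open>j\<close>
  reduces them to Levy's one-dimensional continuity theorem.\<close>

lemma marginal_weak_conv:
  assumes j: "j \<in> J"
  shows "weak_conv_m (\<lambda>n. distr P borel (W n j)) (distr N borel (Z j))"
proof (rule levy_continuity)
  show "real_distribution (distr P borel (W n j))" for n
    using W_measurable[OF j] by simp
  show "real_distribution (distr N borel (Z j))"
    using Z_measurable[OF j] by simp
  fix s :: real
  have single: "(\<Sum>i\<in>J. (if i = j then s else 0) * w i) = s * w j" for w :: "'i \<Rightarrow> real"
  proof -
    have "(\<Sum>i\<in>J. (if i = j then s else 0) * w i) = (\<Sum>i\<in>J. if i = j then s * w i else 0)"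
      by (intro sum.cong) auto
    then show ?thesis using j finite_J by simp
  qed
  show "(\<lambda>n. char (distr P borel (W n j)) s) \<longlonglongrightarrow> char (distr N borel (Z j)) s"
    using char_tendsto[of "\<lambda>i. if i = j then s else 0"] W_measurable[OF j] Z_measurable[OF j]
    unfolding char_def by (simp only: single) (simp add: integral_distr)
qed

lemma eventually_marginal_tail:
  assumes j: "j \<in> J" and e: "e > 0"
  shows "\<exists>L>0. \<forall>\<^sub>F n in sequentially. P.prob {\<omega> \<in> space P. \<bar>W n j \<omega>\<bar> > L} < e"
proof -
  note [measurable] = W_measurable[OF j] Z_measurable[OF j]
  \<comment> \<open>Continuity from above: the tail events of the single variable \<open>Z j\<close>
    decrease to the empty set, which yields \<open>L\<close>.\<close>
  have "(\<lambda>L. N.prob {\<omega> \<in> space N. \<bar>Z j \<omega>\<bar> > real L}) \<longlonglongrightarrow> N.prob (\<Inter>L. {\<omega> \<in> space N. \<bar>Z j \<omega>\<bar> > real L})"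
    by (intro N.finite_Lim_measure_decseq) (auto simp: decseq_def)
  also have "(\<Inter>L. {\<omega> \<in> space N. \<bar>Z j \<omega>\<bar> > real L}) = {}"
    by (auto simp: not_less) (meson not_less real_arch_simple)
  finally have "\<forall>\<^sub>F L in sequentially. N.prob {\<omega> \<in> space N. \<bar>Z j \<omega>\<bar> > real L} < e"
    using e by (intro order_tendstoD(2)) auto
  then obtain L where L: "N.prob {\<omega> \<in> space N. \<bar>Z j \<omega>\<bar> > real L} < e"
    unfolding eventually_sequentially by auto
  \<comment> \<open>A continuous ramp between the indicators of |x| > L + 1 and |x| > L. Weak
    convergence tests continuous functions, so a tail bound for \<open>Z j\<close> at
    \<open>L\<close> becomes one for \<open>W n j\<close> at L + 1.\<close>
  define h :: "real \<Rightarrow> real" where "h x = min 1 (max 0 (\<bar>x\<bar> - real L))" for x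
  have h: "0 \<le> h x" "h x \<le> 1" "\<bar>x\<bar> > real L + 1 \<Longrightarrow> h x = 1" "\<bar>x\<bar> \<le> real L \<Longrightarrow> h x = 0" for x
    by (auto simp: h_def)
  have cont: "isCont h x" for x
    unfolding h_def by (intro continuous_intros)
  have [measurable]: "h \<in> borel_measurable borel"
    unfolding h_def by measurable
  have int: "integrable Q (\<lambda>\<omega>. h (V \<omega>))"
    if "prob_space Q" "V \<in> borel_measurable Q" for Q :: "'c measure" and V
  proof -
    interpret Q: prob_space Q by fact
    show ?thesis using h that(2) by (intro Q.integrable_const_bound[of _ 1]) auto
  qed
  have "(LINT \<omega>|N. h (Z j \<omega>)) \<le> (LINT \<omega>|N. indicator {\<omega> \<in> space N. \<bar>Z j \<omega>\<bar> > real L} \<omega>)"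
  proof (rule integral_mono)
    show "integrable N (indicat_real {\<omega> \<in> space N. \<bar>Z j \<omega>\<bar> > real L})"
      by (intro integrable_real_indicator) (auto simp: N.emeasure_eq_measure)
  qed (use h in \<open>auto simp: int N.prob_space_axioms indicator_def\<close>)
  also have "\<dots> < e" using L by simp
  finally have "(LINT \<omega>|N. h (Z j \<omega>)) < e" .
  moreover have "(\<lambda>n. LINT \<omega>|P. h (W n j \<omega>)) \<longlonglongrightarrow> (LINT \<omega>|N. h (Z j \<omega>))"
    using weak_conv_imp_integral_bdd_continuous_conv[OF _ _ marginal_weak_conv[OF j] cont, of 1] h j
    by (simp add: integral_distr W_measurable Z_measurable)
  ultimately have "\<forall>\<^sub>F n in sequentially. (LINT \<omega>|P. h (W n j \<omega>)) < e"
    by (intro order_tendstoD(2))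
  then have "\<forall>\<^sub>F n in sequentially. P.prob {\<omega> \<in> space P. \<bar>W n j \<omega>\<bar> > real L + 1} < e"
  proof eventually_elim
    case (elim n)
    note [measurable] = W_measurable[OF j, of n]
    have "P.prob {\<omega> \<in> space P. \<bar>W n j \<omega>\<bar> > real L + 1}
        = (LINT \<omega>|P. indicator {\<omega> \<in> space P. \<bar>W n j \<omega>\<bar> > real L + 1} \<omega>)"
      by simp
    also have "\<dots> \<le> (LINT \<omega>|P. h (W n j \<omega>))"
    proof (rule integral_mono)
      show "integrable P (indicat_real {\<omega> \<in> space P. \<bar>W n j \<omega>\<bar> > real L + 1})"
        by (intro integrable_real_indicator) (auto simp: P.emeasure_eq_measure)
    qed (use h in \<open>auto simp: int P.prob_space_axioms indicator_def\<close>)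
    finally show ?case using elim by simp
  qed
  then show ?thesis by (intro exI[of _ "real L + 1"]) auto
qed

text \<open>A union bound over finitely many coordinates. The induction runs over subsets of
  \<open>J\<close> with arbitrary tolerance, because each added coordinate halves it.\<close>

lemma tight:
  assumes e: "e > 0"
  shows "\<exists>L>0. \<forall>\<^sub>F n in sequentially. P.prob {\<omega> \<in> space P. \<exists>j\<in>J. \<bar>W n j \<omega>\<bar> > L} < e"
proof -
  have "\<exists>L>0. \<forall>\<^sub>F n in sequentially. P.prob {\<omega> \<in> space P. \<exists>j\<in>K. \<bar>W n j \<omega>\<bar> > L} < e"
    if "finite K" "K \<subseteq> J" "e > 0" for K e
    using that
  proof (induction K arbitrary: e)
    case empty
    then show ?case by (auto intro: exI[of _ 1])
  next
    case (insert j K)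
    obtain L1 where L1: "L1 > 0" "\<forall>\<^sub>F n in sequentially. P.prob {\<omega> \<in> space P. \<bar>W n j \<omega>\<bar> > L1} < e/2"
      using eventually_marginal_tail[of j "e/2"] insert.prems by auto
    obtain L2 where L2: "L2 > 0"
        "\<forall>\<^sub>F n in sequentially. P.prob {\<omega> \<in> space P. \<exists>j\<in>K. \<bar>W n j \<omega>\<bar> > L2} < e/2"
      using insert.IH[of "e/2"] insert.prems by auto
    have "\<forall>\<^sub>F n in sequentially. P.prob {\<omega> \<in> space P. \<exists>j\<in>insert j K. \<bar>W n j \<omega>\<bar> > max L1 L2} < e"
      using L1(2) L2(2)
    proof eventually_elim
      case (elim n)
      have meas: "{\<omega> \<in> space P. \<bar>W n j \<omega>\<bar> > L} \<in> P.events" if "j \<in> J" for j L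
        using W_measurable[OF that] by measurable
      have eq: "{\<omega> \<in> space P. \<exists>j\<in>K. \<bar>W n j \<omega>\<bar> > L2} = (\<Union>j\<in>K. {\<omega> \<in> space P. \<bar>W n j \<omega>\<bar> > L2})"
        by auto
      have measK: "{\<omega> \<in> space P. \<exists>j\<in>K. \<bar>W n j \<omega>\<bar> > L2} \<in> P.events"
        unfolding eq using insert.prems insert.hyps by (intro sets.finite_UN meas) auto
      have "P.prob {\<omega> \<in> space P. \<exists>j\<in>insert j K. \<bar>W n j \<omega>\<bar> > max L1 L2}
          \<le> P.prob ({\<omega> \<in> space P. \<bar>W n j \<omega>\<bar> > L1} \<union> {\<omega> \<in> space P. \<exists>j\<in>K. \<bar>W n j \<omega>\<bar> > L2})"
        using insert.prems by (intro P.finite_measure_mono sets.Un meas measK) auto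
      also have "\<dots> \<le> P.prob {\<omega> \<in> space P. \<bar>W n j \<omega>\<bar> > L1} + P.prob {\<omega> \<in> space P. \<exists>j\<in>K. \<bar>W n j \<omega>\<bar> > L2}"
        using insert.prems by (intro measure_Un_le meas measK) auto
      finally show ?case using elim by simp
    qed
    then show ?case using L1(1) by (intro exI[of _ "max L1 L2"]) auto
  qed
  from this[OF finite_J order_refl e] show ?thesis .
qed

lemma Min_weak_conv:
  assumes I: "I \<subseteq> J" "I \<noteq> {}"
  shows "weak_conv_m (\<lambda>n. distr P borel (\<lambda>\<omega>. Min ((\<lambda>j. W n j \<omega>) ` I)))
    (distr N borel (\<lambda>\<omega>. Min ((\<lambda>j. Z j \<omega>) ` I)))"
proof -
  have fin: "finite I" using I(1) finite_J by (rule finite_subset)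
  have meas_W [measurable]: "W n j \<in> borel_measurable P" if "j \<in> I" for n j
    using that I(1) W_measurable by auto
  have meas_Z [measurable]: "Z j \<in> borel_measurable N" if "j \<in> I" for j
    using that I(1) Z_measurable by auto
  \<comment> \<open>The constant sequence \<open>Z\<close> is an instance of the same locale, so
    \<open>const.tight\<close> bounds the limit vector as well.\<close>
  interpret const: joint_char_convergence N N J "\<lambda>_. Z" Z
    by unfold_locales (simp_all add: finite_J Z_measurable)
  have Min_W [measurable]: "(\<lambda>\<omega>. Min ((\<lambda>j. W n j \<omega>) ` I)) \<in> borel_measurable P" for n
    using fin by measurable
  have Min_Z [measurable]: "(\<lambda>\<omega>. Min ((\<lambda>j. Z j \<omega>) ` I)) \<in> borel_measurable N"
    using fin by measurable
  show ?thesis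
  proof (rule integral_bdd_continuous_conv_imp_weak_conv)
    fix f :: "real \<Rightarrow> real"
    assume cont: "\<And>x. isCont f x" and bnd: "\<And>x. \<bar>f x\<bar> \<le> 1"
    have contf: "continuous_on UNIV f"
      using cont by (simp add: continuous_at_imp_continuous_on)
    then have [measurable]: "f \<in> borel_measurable borel"
      by (rule borel_measurable_continuous_onI)
    have "(\<lambda>n. LINT \<omega>|P. f (Min ((\<lambda>j. W n j \<omega>) ` I))) \<longlonglongrightarrow> (LINT \<omega>|N. f (Min ((\<lambda>j. Z j \<omega>) ` I)))"
    proof (rule LIMSEQ_I)
      fix e :: real assume e: "e > 0"
      \<comment> \<open>Leaving the box costs twice its probability, hence 2 * e/6 under
        \<open>P\<close> and again under \<open>N\<close>; the convergence of the integrals of the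
        folded function takes the remaining e/3.\<close>
      obtain L1 where L1: "L1 > 0"
          "\<forall>\<^sub>F n in sequentially. P.prob {\<omega> \<in> space P. \<exists>j\<in>J. \<bar>W n j \<omega>\<bar> > L1} < e/6"
        using tight[of "e/6"] e by auto
      obtain L2 where L2: "L2 > 0" "N.prob {\<omega> \<in> space N. \<exists>j\<in>J. \<bar>Z j \<omega>\<bar> > L2} < e/6"
        using const.tight[of "e/6"] e by auto
      define L where "L = max L1 L2"
      have L: "L > 0" "L1 \<le> L" "L2 \<le> L" using L1 by (auto simp: L_def)
      define c where "c x = L * arcsin (sin (x / L))" for x
      have [measurable]: "c \<in> borel_measurable borel"
        unfolding c_def
        by (intro borel_measurable_continuous_onI continuous_intros continuous_on_arcsin) (use L in auto)
      \<comment> \<open>The coordinates are folded inside the minimum: \<open>F\<close> agrees with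
        the test function on the box and keeps its bound 1 off the box.\<close>
      define F where "F w = f (Min ((\<lambda>j. c (w j)) ` I))" for w :: "'i \<Rightarrow> real"
      have apF: "almost_periodic J F"
        unfolding F_def c_def using I fin finite_J
        by (intro almost_periodic_compose_continuous[OF _ contf] almost_periodic_Min almost_periodic_fold) auto
      have F_eq: "f (Min (w ` I)) = F w" if "\<forall>j\<in>J. \<bar>w j\<bar> \<le> L" for w
      proof -
        have "(\<lambda>j. c (w j)) ` I = w ` I"
          unfolding c_def using that I(1) arcsin_sin_fold[OF L(1)] by (intro image_cong) auto
        then show ?thesis by (simp add: F_def)
      qed
      have bndF: "\<bar>F w\<bar> \<le> 1" for w using bnd by (simp add: F_def)
      have FW [measurable]: "(\<lambda>\<omega>. F (\<lambda>j. W n j \<omega>)) \<in> borel_measurable P" for n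
        unfolding F_def using fin by measurable
      have FZ [measurable]: "(\<lambda>\<omega>. F (\<lambda>j. Z j \<omega>)) \<in> borel_measurable N"
        unfolding F_def using fin by measurable
      have eq: "{\<omega> \<in> space Q. \<exists>j\<in>J. \<bar>V j \<omega>\<bar> > K} = (\<Union>j\<in>J. {\<omega> \<in> space Q. \<bar>V j \<omega>\<bar> > K})"
        for Q :: "'c measure" and V :: "'i \<Rightarrow> 'c \<Rightarrow> real" and K by auto
      have sets: "{\<omega> \<in> space Q. \<exists>j\<in>J. \<bar>V j \<omega>\<bar> > K} \<in> sets Q"
        if V: "\<And>j. j \<in> J \<Longrightarrow> V j \<in> borel_measurable Q" for Q :: "'c measure" and V :: "'i \<Rightarrow> 'c \<Rightarrow> real" and K
      proof -
        have "{\<omega> \<in> space Q. \<bar>V j \<omega>\<bar> > K} \<in> sets Q" if "j \<in> J" for j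
        proof -
          note [measurable] = V[OF that]
          show ?thesis by measurable
        qed
        then show ?thesis unfolding eq using finite_J by (intro sets.finite_UN) auto
      qed
      note setsW = sets[of "W n" P for n, OF W_measurable] and setsZ = sets[of Z N, OF Z_measurable]
      have P_le: "P.prob {\<omega> \<in> space P. \<exists>j\<in>J. \<bar>W n j \<omega>\<bar> > L} \<le> P.prob {\<omega> \<in> space P. \<exists>j\<in>J. \<bar>W n j \<omega>\<bar> > L1}" for n
        using L by (intro P.finite_measure_mono setsW) force+
      have N_le: "N.prob {\<omega> \<in> space N. \<exists>j\<in>J. \<bar>Z j \<omega>\<bar> > L} \<le> N.prob {\<omega> \<in> space N. \<exists>j\<in>J. \<bar>Z j \<omega>\<bar> > L2}"
        using L by (intro N.finite_measure_mono setsZ) force+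
      have "\<forall>\<^sub>F n in sequentially. \<bar>(LINT \<omega>|P. F (\<lambda>j. W n j \<omega>)) - (LINT \<omega>|N. F (\<lambda>j. Z j \<omega>))\<bar> < e/3"
        using LIMSEQ_D[OF almost_periodic_integral_tendsto[OF apF FW FZ], of "e/3"] e
        by (auto simp: eventually_sequentially)
      then have "\<forall>\<^sub>F n in sequentially.
          \<bar>(LINT \<omega>|P. F (\<lambda>j. W n j \<omega>)) - (LINT \<omega>|N. F (\<lambda>j. Z j \<omega>))\<bar> < e/3 \<and>
          P.prob {\<omega> \<in> space P. \<exists>j\<in>J. \<bar>W n j \<omega>\<bar> > L} < e/6 \<and>
          N.prob {\<omega> \<in> space N. \<exists>j\<in>J. \<bar>Z j \<omega>\<bar> > L} < e/6"
        using L1(2)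
      proof eventually_elim
        case (elim n)
        then show ?case using le_less_trans[OF P_le[of n]] le_less_trans[OF N_le L2(2)] by blast
      qed
      then have "\<forall>\<^sub>F n in sequentially.
          \<bar>(LINT \<omega>|P. f (Min ((\<lambda>j. W n j \<omega>) ` I))) - (LINT \<omega>|N. f (Min ((\<lambda>j. Z j \<omega>) ` I)))\<bar> < e"
      proof eventually_elim
        case (elim n)
        have "\<bar>(LINT \<omega>|P. f (Min ((\<lambda>j. W n j \<omega>) ` I))) - (LINT \<omega>|P. F (\<lambda>j. W n j \<omega>))\<bar>
            \<le> 2 * P.prob {\<omega> \<in> space P. \<exists>j\<in>J. \<bar>W n j \<omega>\<bar> > L}"
          by (rule P.expectation_diff_le_prob)
            (use bnd bndF F_eq[of "\<lambda>j. W n j _"] in \<open>auto intro: setsW simp: not_less\<close>)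
        moreover have "\<bar>(LINT \<omega>|N. f (Min ((\<lambda>j. Z j \<omega>) ` I))) - (LINT \<omega>|N. F (\<lambda>j. Z j \<omega>))\<bar>
            \<le> 2 * N.prob {\<omega> \<in> space N. \<exists>j\<in>J. \<bar>Z j \<omega>\<bar> > L}"
          by (rule N.expectation_diff_le_prob)
            (use bnd bndF F_eq[of "\<lambda>j. Z j _"] in \<open>auto intro: setsZ simp: not_less\<close>)
        ultimately show ?case using elim by linarith
      qed
      then show "\<exists>n0. \<forall>n\<ge>n0. norm ((LINT \<omega>|P. f (Min ((\<lambda>j. W n j \<omega>) ` I)))
          - (LINT \<omega>|N. f (Min ((\<lambda>j. Z j \<omega>) ` I)))) < e"
        by (auto simp: eventually_sequentially)
    qed
    then show "(\<lambda>n. integral\<^sup>L (distr P borel (\<lambda>\<omega>. Min ((\<lambda>j. W n j \<omega>) ` I))) f)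
        \<longlonglongrightarrow> integral\<^sup>L (distr N borel (\<lambda>\<omega>. Min ((\<lambda>j. Z j \<omega>) ` I))) f"
      by (simp add: integral_distr)
  qed simp_all
qed

end

text \<open>At each point the two distribution functions differ by at most the probability that
  \<open>T n\<close> and \<open>V n\<close> disagree, a transfer in the style of Slutsky.\<close>

lemma (in prob_space) weak_conv_m_asymptotically_equal:
  fixes T V :: "nat \<Rightarrow> 'a \<Rightarrow> real"
  assumes [measurable]: "\<And>n. T n \<in> borel_measurable M" "\<And>n. V n \<in> borel_measurable M"
    and conv: "weak_conv_m (\<lambda>n. distr M borel (V n)) D"
    and eq: "(\<lambda>n. prob {\<omega> \<in> space M. T n \<omega> \<noteq> V n \<omega>}) \<longlonglongrightarrow> 0"
  shows "weak_conv_m (\<lambda>n. distr M borel (T n)) D"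
  unfolding weak_conv_m_def weak_conv_def
proof (intro allI impI)
  fix x assume "isCont (cdf D) x"
  then have lim: "(\<lambda>n. cdf (distr M borel (V n)) x) \<longlonglongrightarrow> cdf D x"
    using conv by (auto simp: weak_conv_m_def weak_conv_def)
  have cdf: "cdf (distr M borel U) x = prob {\<omega> \<in> space M. U \<omega> \<le> x}"
    if [measurable]: "U \<in> borel_measurable M" for U
    by (auto simp: cdf_def measure_distr intro!: arg_cong[where f = prob])
  have le: "prob {\<omega> \<in> space M. U \<omega> \<le> x}
      \<le> prob {\<omega> \<in> space M. U' \<omega> \<le> x} + prob {\<omega> \<in> space M. T n \<omega> \<noteq> V n \<omega>}"
    if UU: "(U, U') \<in> {(T n, V n), (V n, T n)}" for U U' n
  proof -
    have [measurable]: "U \<in> borel_measurable M" "U' \<in> borel_measurable M" using UU by auto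
    have "prob {\<omega> \<in> space M. U \<omega> \<le> x}
        \<le> prob ({\<omega> \<in> space M. U' \<omega> \<le> x} \<union> {\<omega> \<in> space M. T n \<omega> \<noteq> V n \<omega>})"
      using UU by (intro finite_measure_mono) auto
    also have "\<dots> \<le> prob {\<omega> \<in> space M. U' \<omega> \<le> x} + prob {\<omega> \<in> space M. T n \<omega> \<noteq> V n \<omega>}"
      by (intro measure_Un_le) auto
    finally show ?thesis .
  qed
  have "(\<lambda>n. cdf (distr M borel (T n)) x - cdf (distr M borel (V n)) x) \<longlonglongrightarrow> 0"
  proof (rule Lim_null_comparison[OF always_eventually eq], intro allI)
    fix n
    show "norm (cdf (distr M borel (T n)) x - cdf (distr M borel (V n)) x)
        \<le> prob {\<omega> \<in> space M. T n \<omega> \<noteq> V n \<omega>}"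
      using le[of "T n" "V n" n] le[of "V n" "T n" n] by (simp add: cdf abs_le_iff)
  qed
  from tendsto_add[OF this lim] show "(\<lambda>n. cdf (distr M borel (T n)) x) \<longlonglongrightarrow> cdf D x"
    by simp
qed

section \<open>The central limit theorem for characteristic functions\<close>

text \<open>Dividing by the standard deviation would require positive variance. Dividing by sqrt n
  alone and stating the limit through characteristic functions also covers degenerate summands, for
  which both sides are 1.\<close>

lemma (in prob_space) central_limit_theorem_char:
  fixes Y :: "nat \<Rightarrow> 'a \<Rightarrow> real"
  assumes indep: "indep_vars (\<lambda>i. borel) Y UNIV"
    and distr: "\<And>n. distr M borel (Y n) = \<mu>"
    and square_integrable: "integrable \<mu> (\<lambda>x. x\<^sup>2)"
  shows "(\<lambda>n. CLINT \<omega>|M. iexp ((\<Sum>i<n. Y i \<omega> - (LINT x|\<mu>. x)) / sqrt n))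
    \<longlonglongrightarrow> complex_of_real (exp (- (LINT x|\<mu>. (x - (LINT x|\<mu>. x))\<^sup>2) / 2))"
proof -
  have Y [measurable]: "Y n \<in> borel_measurable M" for n
    using indep by (simp add: indep_vars_def2)
  define m where "m = (LINT x|\<mu>. x)"
  define v where "v = (LINT x|\<mu>. (x - m)\<^sup>2)"
  have mean: "expectation (Y n) = m" for n
    by (simp add: m_def distr[of n, symmetric] integral_distr)
  have var: "expectation (\<lambda>\<omega>. (Y n \<omega> - m)\<^sup>2) = v" for n
    by (simp add: v_def distr[of n, symmetric] integral_distr)
  have sq: "integrable M (\<lambda>\<omega>. (Y n \<omega>)\<^sup>2)" for n
    using square_integrable by (simp add: distr[of n, symmetric] integrable_distr_eq)
  have int: "integrable M (Y n)" for n
    by (rule square_integrable_imp_integrable[OF Y sq])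
  have "v \<ge> 0" by (simp add: v_def)
  then consider "v > 0" | "v = 0" by linarith
  then have "(\<lambda>n. CLINT \<omega>|M. iexp ((\<Sum>i<n. Y i \<omega> - m) / sqrt n)) \<longlonglongrightarrow> complex_of_real (exp (- v / 2))"
  proof cases
    case 1
    let ?S = "\<lambda>n \<omega>. (\<Sum>i<n. Y i \<omega> - m) / sqrt (real n * (sqrt v)\<^sup>2)"
    have "weak_conv_m (\<lambda>n. distr M borel (?S n)) std_normal_distribution"
      using 1 by (intro central_limit_theorem[OF indep mean _ sq _ distr]) (simp_all add: mean var)
    \<comment> \<open>Evaluation at sqrt v undoes the standardisation: \<open>sqrt v * ?S n\<close>
      is the sum over sqrt n, and the standard normal characteristic function takes the value
      exp(-v/2) there.\<close>
    then have "(\<lambda>n. char (distr M borel (?S n)) (sqrt v)) \<longlonglongrightarrow> char std_normal_distribution (sqrt v)"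
      by (intro levy_continuity1 real_dist_normal_dist real_distribution_distr) simp_all
    moreover have "sqrt v * ?S n \<omega> = (\<Sum>i<n. Y i \<omega> - m) / sqrt n" for n \<omega>
      using 1 by (simp add: real_sqrt_mult)
    then have "char (distr M borel (?S n)) (sqrt v) = (CLINT \<omega>|M. iexp ((\<Sum>i<n. Y i \<omega> - m) / sqrt n))" for n
      unfolding char_def by (subst integral_distr) (simp_all only: Y, measurable)
    moreover have "char std_normal_distribution (sqrt v) = complex_of_real (exp (- v / 2))"
      using 1 by (simp add: char_std_normal_distribution)
    ultimately show ?thesis by simp
  next
    case 2
    \<comment> \<open>Zero variance makes every \<open>Y n\<close> almost surely equal to
      \<open>m\<close>, so the exponential integrand is almost surely 1.\<close>
    have "AE \<omega> in M. (Y n \<omega> - m)\<^sup>2 = 0" for n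
    proof (subst integral_nonneg_eq_0_iff_AE[symmetric])
      show "integrable M (\<lambda>\<omega>. (Y n \<omega> - m)\<^sup>2)"
        using sq int by (simp add: power2_diff)
    qed (use var 2 in auto)
    then have ae: "AE \<omega> in M. \<forall>n. Y n \<omega> = m"
      by (simp add: AE_all_countable)
    have "(CLINT \<omega>|M. iexp ((\<Sum>i<n. Y i \<omega> - m) / sqrt n)) = (CLINT \<omega>|M. 1)" for n
      by (rule integral_cong_AE) (use ae in \<open>auto elim!: eventually_mono\<close>)
    then show ?thesis using 2 by (simp add: prob_space)
  qed
  then show ?thesis by (simp add: m_def v_def)
qed

section \<open>Independent samples: shifted index sets, coverage of the support and the joint
  limit\<close>

lemma (in prob_space) indep_vars_reindex:
  assumes indep: "indep_vars M' X (f ` I)" and inj: "inj_on f I"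
  shows "indep_vars (\<lambda>i. M' (f i)) (\<lambda>i. X (f i)) I"
  unfolding indep_vars_def2 indep_sets_def
proof (intro conjI ballI allI impI)
  have X: "X (f i) \<in> measurable M (M' (f i))" if "i \<in> I" for i
    using indep that by (auto simp: indep_vars_def2)
  show "random_variable (M' (f i)) (X (f i))" if "i \<in> I" for i
    using X that .
  show "{X (f i) -` A \<inter> space M |A. A \<in> sets (M' (f i))} \<subseteq> events" if "i \<in> I" for i
    using X[OF that] by (auto intro: measurable_sets)
  fix J A assume J: "J \<subseteq> I" "J \<noteq> {}" "finite J"
    and A: "A \<in> (\<Pi> j\<in>J. {X (f j) -` A \<inter> space M |A. A \<in> sets (M' (f j))})"
  then have "\<forall>j\<in>J. \<exists>B. A j = X (f j) -` B \<inter> space M \<and> B \<in> sets (M' (f j))"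
    by auto
  then obtain B where B: "\<And>j. j \<in> J \<Longrightarrow> A j = X (f j) -` B j \<inter> space M" "\<And>j. j \<in> J \<Longrightarrow> B j \<in> sets (M' (f j))"
    by metis
  \<comment> \<open>The sets chosen on \<open>J\<close> are carried to the image of \<open>J\<close>
    under \<open>f\<close>; by injectivity the product formula there pulls back to
    \<open>J\<close>.\<close>
  define C where "C = B \<circ> the_inv_into J f"
  have injJ: "inj_on f J" using inj J(1) by (rule inj_on_subset)
  then have C: "C (f j) = B j" if "j \<in> J" for j
    using that by (simp add: C_def the_inv_into_f_f)
  have "prob (\<Inter>i\<in>f ` J. X i -` C i \<inter> space M) = (\<Prod>i\<in>f ` J. prob (X i -` C i \<inter> space M))"
    by (rule indep_varsD[OF indep]) (use J B C in auto)
  moreover have "A ` J = (\<lambda>i. X i -` C i \<inter> space M) ` f ` J"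
    unfolding image_image using B(1) C by (intro image_cong) auto
  ultimately show "prob (\<Inter> (A ` J)) = (\<Prod>j\<in>J. prob (A j))"
    using B(1) C by (simp add: prod.reindex[OF injJ] cong: prod.cong)
qed

text \<open>Observations start at index 1 and \<open>X 0\<close> is unconstrained, hence the
  condition \<open>i \<ge> 1\<close> in the facts below.\<close>

locale iid_sample = prob_space P
  for P :: "'a measure" and X :: "nat \<Rightarrow> 'a \<Rightarrow> 'c" and p :: "'c pmf" +
  assumes indep: "indep_vars (\<lambda>_. count_space UNIV) X {1..}"
    and law: "\<And>i. i \<ge> 1 \<Longrightarrow> distr P (count_space UNIV) (X i) = measure_pmf p"
begin

lemma X_measurable [measurable]: "i \<ge> 1 \<Longrightarrow> X i \<in> measurable P (count_space UNIV)"
  using indep by (auto simp: indep_vars_def2)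

lemma prob_X: "i \<ge> 1 \<Longrightarrow> prob (X i -` A \<inter> space P) = measure_pmf.prob p A"
  using X_measurable by (simp add: law[symmetric] measure_distr)

lemma expectation_X:
  fixes f :: "'c \<Rightarrow> real"
  shows "i \<ge> 1 \<Longrightarrow> expectation (\<lambda>\<omega>. f (X i \<omega>)) = measure_pmf.expectation p f"
  using X_measurable by (simp add: law[symmetric] integral_distr)

lemma AE_X_in_set_pmf: "AE \<omega> in P. \<forall>i\<ge>1. X i \<omega> \<in> set_pmf p"
proof -
  have "AE \<omega> in P. X i \<omega> \<in> set_pmf p" if i: "i \<ge> 1" for i
  proof -
    have "AE x in distr P (count_space UNIV) (X i). x \<in> set_pmf p"
      unfolding law[OF i] by (rule AE_measure_pmf)
    then show ?thesis using X_measurable[OF i] by (simp add: AE_distr_iff)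
  qed
  then show ?thesis by (auto simp: AE_all_countable)
qed

text \<open>Independence gives the value (1 - pmf p x)^n, and \<open>x\<close> carries positive
  mass. Applied at both endpoints of the support, this makes the empirical range the true one with
  probability tending to 1.\<close>

lemma prob_never_tendsto_0:
  assumes x: "x \<in> set_pmf p"
  shows "(\<lambda>n. prob {\<omega> \<in> space P. \<forall>i\<in>{1..n}. X i \<omega> \<noteq> x}) \<longlonglongrightarrow> 0"
proof -
  let ?q = "1 - pmf p x"
  have q: "measure_pmf.prob p (UNIV - {x}) = ?q"
    using measure_pmf.prob_compl[of "{x}" p] by (simp add: measure_pmf_single)
  have "prob {\<omega> \<in> space P. \<forall>i\<in>{1..n}. X i \<omega> \<noteq> x} = ?q ^ n" for n
  proof (cases "n = 0")
    \<comment> \<open>\<open>indep_varsD\<close> is applied to the index set {1..n}, which has to be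
      nonempty; for n = 0 both sides are 1.\<close>
    case False
    then have "{\<omega> \<in> space P. \<forall>i\<in>{1..n}. X i \<omega> \<noteq> x} = (\<Inter>i\<in>{1..n}. X i -` (UNIV - {x}) \<inter> space P)"
      by auto
    also have "prob \<dots> = (\<Prod>i\<in>{1..n}. prob (X i -` (UNIV - {x}) \<inter> space P))"
      using False by (intro indep_varsD[OF indep]) auto
    also have "\<dots> = (\<Prod>i\<in>{1..n}. ?q)"
      by (intro prod.cong refl) (simp add: prob_X q)
    finally show ?thesis by simp
  qed (simp add: prob_space)
  moreover have "(\<lambda>n. ?q ^ n) \<longlonglongrightarrow> 0"
    using x by (intro LIMSEQ_power_zero) (simp add: pmf_positive pmf_le_1)
  ultimately show ?thesis by simp
qed

text \<open>Cramer-Wold: for fixed \<open>t\<close> the linear combination \<open>F\<close> of the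
  \<open>f j\<close> turns the sample into real i.i.d. variables, and their variance is the
  quadratic form of the covariances at \<open>t\<close>. The common bound \<open>B\<close> supplies
  all moments.\<close>

lemma char_tendsto_normal:
  fixes f :: "'j \<Rightarrow> 'c \<Rightarrow> real" and t :: "'j \<Rightarrow> real"
  assumes bnd: "\<And>j x. j \<in> J \<Longrightarrow> \<bar>f j x\<bar> \<le> B"
  shows "(\<lambda>n. CLINT \<omega>|P. iexp (\<Sum>j\<in>J. t j *
        ((\<Sum>i=1..n. f j (X i \<omega>) - measure_pmf.expectation p (f j)) / sqrt n)))
    \<longlonglongrightarrow> complex_of_real (exp (- (\<Sum>i\<in>J. \<Sum>j\<in>J.
        t i * covariance P (\<lambda>\<omega>. f i (X 1 \<omega>)) (\<lambda>\<omega>. f j (X 1 \<omega>)) * t j) / 2))"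
proof -
  define F where "F x = (\<Sum>j\<in>J. t j * f j x)" for x
  define \<mu> where "\<mu> = distr (measure_pmf p) borel F"
  define e where "e j = measure_pmf.expectation p (f j)" for j
  \<comment> \<open>The limit theorem indexes its variables from 0, so the sample is shifted along
    \<open>Suc\<close>, whose range is {1..}.\<close>
  have "indep_vars (\<lambda>_. count_space UNIV) X (range Suc)"
    using indep by (simp only: greaterThan_0[symmetric] atLeast_Suc_greaterThan[symmetric] One_nat_def)
  then have "indep_vars (\<lambda>_. count_space UNIV) (\<lambda>n. X (Suc n)) UNIV"
    by (rule indep_vars_reindex) simp
  then have indep': "indep_vars (\<lambda>_. borel) (\<lambda>n \<omega>. F (X (Suc n) \<omega>)) UNIV"
    by (rule indep_vars_compose2) simp
  have distr_F: "distr P borel (\<lambda>\<omega>. F (X (Suc n) \<omega>)) = \<mu>" for n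
    unfolding \<mu>_def by (subst law[symmetric, of "Suc n"]) (simp_all add: distr_distr comp_def)
  have bndF: "\<bar>F x\<bar> \<le> (\<Sum>j\<in>J. \<bar>t j\<bar> * B)" for x
    unfolding F_def by (rule order_trans[OF sum_abs])
      (auto intro!: sum_mono mult_left_mono bnd simp: abs_mult)
  have "(F x)\<^sup>2 \<le> (\<Sum>j\<in>J. \<bar>t j\<bar> * B)\<^sup>2" for x
    using power_mono[OF bndF[of x] abs_ge_zero, of 2] by simp
  then have sq: "integrable \<mu> (\<lambda>x. x\<^sup>2)"
    unfolding \<mu>_def by (subst integrable_distr_eq)
      (auto intro!: measure_pmf.integrable_const_bound[of _ "(\<Sum>j\<in>J. \<bar>t j\<bar> * B)\<^sup>2"])
  have int: "integrable (measure_pmf p) (f j)" if "j \<in> J" for j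
    using bnd[OF that] by (intro measure_pmf.integrable_const_bound[of _ B]) auto
  have mean: "(LINT x|\<mu>. x) = (\<Sum>j\<in>J. t j * e j)"
    unfolding \<mu>_def F_def e_def using int by (simp add: integral_distr)
  have cov: "covariance P (\<lambda>\<omega>. f i (X 1 \<omega>)) (\<lambda>\<omega>. f j (X 1 \<omega>))
      = measure_pmf.expectation p (\<lambda>x. (f i x - e i) * (f j x - e j))" for i j
    using expectation_X[of 1 "\<lambda>x. (f i x - e i) * (f j x - e j)"] expectation_X[of 1 "f i"] expectation_X[of 1 "f j"]
    by (simp add: covariance_def e_def)
  have int2: "integrable (measure_pmf p) (\<lambda>x. (f i x - e i) * (f j x - e j))" if "i \<in> J" "j \<in> J" for i j
  proof (rule measure_pmf.integrable_const_bound[of _ "(B + \<bar>e i\<bar>) * (B + \<bar>e j\<bar>)"])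
    have "\<bar>f i x - e i\<bar> * \<bar>f j x - e j\<bar> \<le> (B + \<bar>e i\<bar>) * (B + \<bar>e j\<bar>)" for x
      using bnd[OF that(1), of x] bnd[OF that(2), of x] by (intro mult_mono) linarith+
    then show "AE x in measure_pmf p. norm ((f i x - e i) * (f j x - e j)) \<le> (B + \<bar>e i\<bar>) * (B + \<bar>e j\<bar>)"
      by (simp add: abs_mult)
  qed simp
  have "(LINT x|\<mu>. (x - (\<Sum>j\<in>J. t j * e j))\<^sup>2)
      = measure_pmf.expectation p (\<lambda>x. (F x - (\<Sum>j\<in>J. t j * e j))\<^sup>2)"
    unfolding \<mu>_def by (subst integral_distr) auto
  \<comment> \<open>The square of a centred linear combination, expanded as a double sum, produces
    the quadratic form.\<close>
  also have "\<dots> = measure_pmf.expectation p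
      (\<lambda>x. \<Sum>i\<in>J. \<Sum>j\<in>J. t i * ((f i x - e i) * (f j x - e j)) * t j)"
  proof (intro Bochner_Integration.integral_cong refl)
    fix x
    have "F x - (\<Sum>j\<in>J. t j * e j) = (\<Sum>j\<in>J. t j * (f j x - e j))"
      by (simp add: F_def sum_subtractf right_diff_distrib)
    then show "(F x - (\<Sum>j\<in>J. t j * e j))\<^sup>2 = (\<Sum>i\<in>J. \<Sum>j\<in>J. t i * ((f i x - e i) * (f j x - e j)) * t j)"
      by (simp add: power2_eq_square sum_product mult_ac)
  qed
  also have "\<dots> = (\<Sum>i\<in>J. \<Sum>j\<in>J. t i * covariance P (\<lambda>\<omega>. f i (X 1 \<omega>)) (\<lambda>\<omega>. f j (X 1 \<omega>)) * t j)"
    unfolding cov using int2 by simp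
  finally have var: "(LINT x|\<mu>. (x - (\<Sum>j\<in>J. t j * e j))\<^sup>2)
      = (\<Sum>i\<in>J. \<Sum>j\<in>J. t i * covariance P (\<lambda>\<omega>. f i (X 1 \<omega>)) (\<lambda>\<omega>. f j (X 1 \<omega>)) * t j)" .
  have sum: "(\<Sum>i<n. F (X (Suc i) \<omega>) - (\<Sum>j\<in>J. t j * e j)) / sqrt n
      = (\<Sum>j\<in>J. t j * ((\<Sum>i=1..n. f j (X i \<omega>) - e j) / sqrt n))" for n \<omega>
  proof -
    have "(\<Sum>i<n. F (X (Suc i) \<omega>) - (\<Sum>j\<in>J. t j * e j)) = (\<Sum>i=1..n. F (X i \<omega>) - (\<Sum>j\<in>J. t j * e j))"
      by (rule sum.reindex_bij_witness[of _ "\<lambda>i. i - 1" Suc]) auto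
    also have "\<dots> = (\<Sum>i=1..n. \<Sum>j\<in>J. t j * (f j (X i \<omega>) - e j))"
      by (simp add: F_def sum_subtractf right_diff_distrib)
    also have "\<dots> = (\<Sum>j\<in>J. t j * (\<Sum>i=1..n. f j (X i \<omega>) - e j))"
      unfolding sum_distrib_left by (rule sum.swap)
    finally show ?thesis by (simp add: sum_divide_distrib[of _ J])
  qed
  show ?thesis
    using central_limit_theorem_char[OF indep' distr_F sq] unfolding mean var sum unfolding e_def .
qed

end

section \<open>Finite differences and the empirical distribution\<close>

lemma nabla_0: "nabla 0 q j = q j"
  by (simp add: nabla_def)

text \<open>The sign (-1)^k reverses each forward difference. The facts on sums, quotients, bounds
  and integrals are inductions along this recursion.\<close>

lemma nabla_Suc: "nabla (Suc k) q j = nabla k q j - nabla k q (j + 1)"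
  by (simp add: nabla_def fdiff_def algebra_simps)

lemma nabla_sum: "nabla k (\<lambda>x. \<Sum>i\<in>A. q i x) j = (\<Sum>i\<in>A. nabla k (q i) j)"
  by (induction k arbitrary: j) (simp_all add: nabla_0 nabla_Suc sum_subtractf)

lemma nabla_divide: "nabla k (\<lambda>x. q x / c) j = nabla k q j / c"
  by (induction k arbitrary: j) (simp_all add: nabla_0 nabla_Suc diff_divide_distrib)

text \<open>Each difference at most doubles the bound. Applied to indicators, this gives the bound
  \<open>B\<close> of \<open>char_tendsto_normal\<close>.\<close>

lemma nabla_abs_le: "(\<And>x. \<bar>q x\<bar> \<le> 1) \<Longrightarrow> \<bar>nabla k q j\<bar> \<le> 2 ^ k"
proof (induction k arbitrary: j)
  case (Suc k)
  show ?case
    using Suc.IH[OF Suc.prems, of j] Suc.IH[OF Suc.prems, of "j + 1"] by (simp add: nabla_Suc)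
qed (simp add: nabla_0)

text \<open>The two claims share one induction, since integrating a difference termwise uses the
  integrability from the previous order.\<close>

lemma nabla_integral:
  assumes "\<And>x. integrable M (\<lambda>\<omega>. q \<omega> x)"
  shows "integrable M (\<lambda>\<omega>. nabla k (q \<omega>) j)"
    and "nabla k (\<lambda>x. LINT \<omega>|M. q \<omega> x) j = (LINT \<omega>|M. nabla k (q \<omega>) j)"
proof -
  have "integrable M (\<lambda>\<omega>. nabla k (q \<omega>) j) \<and> nabla k (\<lambda>x. LINT \<omega>|M. q \<omega> x) j = (LINT \<omega>|M. nabla k (q \<omega>) j)"
    using assms by (induction k arbitrary: j) (simp_all add: nabla_0 nabla_Suc)
  then show "integrable M (\<lambda>\<omega>. nabla k (q \<omega>) j)"
    and "nabla k (\<lambda>x. LINT \<omega>|M. q \<omega> x) j = (LINT \<omega>|M. nabla k (q \<omega>) j)"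
    by auto
qed

text \<open>p(x) is the expectation of the indicator at x, and \<open>nabla\<close> is linear; so
  subtracting \<open>nabla k (pmf p) j\<close> centres the summands of the empirical
  difference.\<close>

lemma nabla_pmf: "nabla k (pmf p) j = measure_pmf.expectation p (\<lambda>x. nabla k (indicat_real {x}) j)"
proof -
  have "measure_pmf.expectation p (\<lambda>y. indicat_real {y} x) = pmf p x" for x
  proof -
    have "(\<lambda>y. indicat_real {y} x) = indicat_real {x}"
      by (auto simp: indicator_def)
    then show ?thesis by (simp add: measure_pmf_single)
  qed
  moreover have "integrable (measure_pmf p) (\<lambda>y. indicat_real {y} x)" for x
    by (intro measure_pmf.integrable_const_bound[of _ 1]) auto
  ultimately show ?thesis
    using nabla_integral(2)[of "measure_pmf p" "\<lambda>y. indicat_real {y}" k j] by simp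
qed

lemma nabla_emp_pmf: "nabla k (emp_pmf X n \<omega>) j = (\<Sum>i=1..n. nabla k (indicat_real {X i \<omega>}) j) / n"
proof -
  have "emp_pmf X n \<omega> = (\<lambda>x. (\<Sum>i=1..n. indicat_real {X i \<omega>} x) / real n)"
    by (simp add: emp_pmf_def fun_eq_iff)
  then show ?thesis by (simp add: nabla_divide nabla_sum)
qed

lemma sqrt_nabla_emp_pmf:
  "sqrt n * (nabla k (emp_pmf X n \<omega>) j - c) = (\<Sum>i=1..n. nabla k (indicat_real {X i \<omega>}) j - c) / sqrt n"
proof (cases "n = 0")
  case False
  then have "sqrt n * (S / n - c) = (S - n * c) / sqrt n" for S :: real
    by (simp add: field_simps)
  then show ?thesis by (simp add: nabla_emp_pmf sum_subtractf)
qed simp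

section \<open>Measurability of the statistic through the finite list of observations\<close>

lemma measurable_map_count_space [measurable]:
  fixes X :: "'i \<Rightarrow> 'a \<Rightarrow> 'c::countable"
  assumes "\<And>i. i \<in> set xs \<Longrightarrow> X i \<in> measurable M (count_space UNIV)"
  shows "(\<lambda>\<omega>. map (\<lambda>i. X i \<omega>) xs) \<in> measurable M (count_space UNIV)"
  using assms
proof (induction xs)
  case (Cons i xs)
  have "(\<lambda>\<omega>. (X i \<omega>, map (\<lambda>i. X i \<omega>) xs)) \<in> measurable M (count_space UNIV \<Otimes>\<^sub>M count_space UNIV)"
    using Cons by (intro measurable_Pair) auto
  then have "(\<lambda>\<omega>. (X i \<omega>, map (\<lambda>i. X i \<omega>) xs)) \<in> measurable M (count_space UNIV)"
    by (simp add: pair_measure_countable)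
  then have "(\<lambda>\<omega>. (\<lambda>(y, ys). y # ys) (X i \<omega>, map (\<lambda>i. X i \<omega>) xs)) \<in> measurable M (count_space UNIV)"
    by (rule measurable_compose) simp
  then show ?case by simp
qed simp

text \<open>The range of the minimum depends on the data. The statistic nevertheless factors through
  the list of the first n observations, an element of a countable discrete space, on which every
  function is measurable.\<close>

lemma emp_min_nabla_measurable:
  assumes "\<And>i. i \<ge> 1 \<Longrightarrow> X i \<in> measurable M (count_space UNIV)"
  shows "emp_min_nabla k X n \<in> borel_measurable M"
proof -
  \<comment> \<open>A list is read as a sample over the one-point space \<open>unit\<close>; the
    shift i - 1 matches observations counted from 1 with list positions counted from 0.\<close>
  define Y where "Y l = (\<lambda>i (_::unit). l ! (i - 1) :: int)" for l
  define s where "s \<omega> = map (\<lambda>i. X i \<omega>) [1..<Suc n]" for \<omega>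
  have X_eq: "X i \<omega> = Y (s \<omega>) i ()" if "i \<in> {1..n}" for i \<omega>
    using that by (auto simp: Y_def s_def simp del: upt_Suc)
  have "emp_pmf X n \<omega> = emp_pmf (Y (s \<omega>)) n ()" for \<omega>
    unfolding emp_pmf_def fun_eq_iff using X_eq
    by (auto intro!: arg_cong2[where f = "(/)"] sum.cong)
  moreover have "(\<lambda>i. X i \<omega>) ` {1..n} = (\<lambda>i. Y (s \<omega>) i ()) ` {1..n}" for \<omega>
    using X_eq by (intro image_cong) auto
  ultimately have "emp_min_nabla k X n = (\<lambda>\<omega>. emp_min_nabla k (Y (s \<omega>)) n ())"
    by (simp only: emp_min_nabla_def[abs_def] emp_index_set_def)
  moreover have "s \<in> measurable M (count_space UNIV)"
    unfolding s_def[abs_def] using assms by (intro measurable_map_count_space) auto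
  then have "(\<lambda>\<omega>. emp_min_nabla k (Y (s \<omega>)) n ()) \<in> borel_measurable M"
    by (rule measurable_compose) simp
  ultimately show ?thesis by simp
qed

text \<open>Let i minimise \<open>w\<close> on \<open>I\<close>. Off \<open>I\<close>, c (q j -
  \<rho>) = w j + c (r j - \<rho>) is at least -L + c \<delta>, hence at least L and at least w i.
  So i minimises \<open>q\<close> on all of \<open>S\<close>, and its drift is 0. The factor 2 in 2
  L pays for the fluctuations at i and at j.\<close>

lemma scaled_Min_eq_Min_active:
  fixes q w :: "'j \<Rightarrow> real"
  assumes fin: "finite S" and I: "I \<subseteq> S" "I \<noteq> {}" and c: "c > 0"
    and w: "\<And>j. j \<in> S \<Longrightarrow> w j = c * (q j - r j)"
    and active: "\<And>j. j \<in> I \<Longrightarrow> r j = \<rho>"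
    and inactive: "\<And>j. j \<in> S - I \<Longrightarrow> \<rho> + \<delta> \<le> r j"
    and L: "\<And>j. j \<in> S \<Longrightarrow> \<bar>w j\<bar> \<le> L" "2 * L \<le> c * \<delta>"
  shows "c * (Min (q ` S) - \<rho>) = Min (w ` I)"
proof -
  have finI: "finite I" using I(1) fin by (rule finite_subset)
  then have "Min (w ` I) \<in> w ` I" using I(2) by (intro Min_in) auto
  then obtain i where i: "i \<in> I" "Min (w ` I) = w i" by auto
  have wi: "w i = c * (q i - \<rho>)" using i(1) I(1) w active by auto
  have "q i \<le> q j" if j: "j \<in> S" for j
  proof -
    have "w i \<le> c * (q j - \<rho>)"
    proof (cases "j \<in> I")
      case True
      then have "w i \<le> w j" using i(2) finI by (metis Min_le finite_imageI imageI)
      then show ?thesis using w[OF j] active[OF True] by simp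
    next
      case False
      have "w i \<le> L" "- L \<le> w j" using L(1)[of i] L(1)[OF j] i(1) I(1) by auto
      moreover have "c * \<delta> \<le> c * (r j - \<rho>)"
        using inactive[of j] j False c by (intro mult_left_mono) auto
      moreover have "c * (q j - \<rho>) = w j + c * (r j - \<rho>)"
        using w[OF j] by (simp add: algebra_simps)
      ultimately show ?thesis using L(2) by linarith
    qed
    then show ?thesis using c by (simp add: wi)
  qed
  then have "Min (q ` S) = q i"
    using fin i(1) I(1) by (intro Min_eqI) auto
  then show ?thesis using i(2) wi by simp
qed

lemma emp_index_set_eq:
  assumes "\<And>i. i \<in> {1..n} \<Longrightarrow> X i \<omega> \<in> {m..M}" "\<exists>i\<in>{1..n}. X i \<omega> = m" "\<exists>i\<in>{1..n}. X i \<omega> = M"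
  shows "emp_index_set k X n \<omega> = index_set k m M"
proof -
  have "Min ((\<lambda>i. X i \<omega>) ` {1..n}) = m"
    using assms by (intro Min_eqI) auto
  moreover have "Max ((\<lambda>i. X i \<omega>) ` {1..n}) = M"
    using assms by (intro Max_eqI) auto
  ultimately show ?thesis by (simp add: emp_index_set_def index_set_def)
qed

section \<open>Comparison of the statistic with the minimum of the fluctuations over the level
  set\<close>

theorem theorem1:
  fixes k :: nat and m M :: int and p :: "int pmf"
    and P :: "'a measure" and X :: "nat \<Rightarrow> 'a \<Rightarrow> int"
    and N :: "'b measure" and Z :: "int \<Rightarrow> 'b \<Rightarrow> real"
  defines "\<rho> \<equiv> min_nabla k m M (pmf p)"
  assumes mM: "m \<le> M - int k"
    and supp: "set_pmf p = {m..M}"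
    and P: "prob_space P"
    and indep: "prob_space.indep_vars P (\<lambda>_. count_space UNIV) X {1..}"
    and law: "\<And>i. i \<ge> 1 \<Longrightarrow> distr P (count_space UNIV) (X i) = measure_pmf p"
    and N: "prob_space N"
    and Z: "normal_vector N (index_set k m M) Z (\<lambda>_. 0) (Sigma_nabla P k (X 1))"
  shows "weak_conv_m
           (\<lambda>n. distr P borel (\<lambda>\<omega>. sqrt (real n) * (emp_min_nabla k X n \<omega> - \<rho>)))
           (distr N borel (\<lambda>\<omega>. Min ((\<lambda>j. Z j \<omega>) ` level_set k m M (pmf p) \<rho>)))
         \<and> (\<rho> = 0 \<longrightarrow>
              k_monotone k m M (pmf p) \<and>
              level_set k m M (pmf p) 0 = index_set k m M - knots k m M (pmf p))"
proof (intro conjI impI)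
  let ?S = "index_set k m M" and ?I = "level_set k m M (pmf p) \<rho>"
  interpret iid_sample P X p
    by (intro iid_sample.intro iid_sample_axioms.intro P indep law)
  interpret N: prob_space N by fact
  have S: "finite ?S" "?S \<noteq> {}" using mM by (auto simp: index_set_def)
  have \<rho>_le: "\<rho> \<le> nabla k (pmf p) j" if "j \<in> ?S" for j
    using S that by (auto simp: \<rho>_def min_nabla_def)
  have "\<rho> \<in> nabla k (pmf p) ` ?S"
    unfolding \<rho>_def min_nabla_def using S by (intro Min_in) auto
  then have I: "?I \<subseteq> ?S" "?I \<noteq> {}" by (auto simp: level_set_def)

  define f :: "int \<Rightarrow> int \<Rightarrow> real" where "f j x = nabla k (indicat_real {x}) j" for j x
  define W where "W n j \<omega> = sqrt (real n) * (nabla k (emp_pmf X n \<omega>) j - nabla k (pmf p) j)" for n j \<omega>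
  have W_eq: "W n j \<omega> = (\<Sum>i=1..n. f j (X i \<omega>) - measure_pmf.expectation p (f j)) / sqrt n" for n j \<omega>
    unfolding W_def sqrt_nabla_emp_pmf nabla_pmf f_def[abs_def] ..
  have W [measurable]: "W n j \<in> borel_measurable P" for n j
  proof -
    have [measurable]: "(\<lambda>\<omega>. f j (X i \<omega>)) \<in> borel_measurable P" if "i \<in> {1..n}" for i
      using that by (intro measurable_compose[OF X_measurable]) auto
    show ?thesis unfolding W_eq[abs_def] by measurable
  qed
  have Z_meas: "\<And>j. j \<in> ?S \<Longrightarrow> Z j \<in> borel_measurable N"
    using Z by (simp add: normal_vector_def)
  have char: "(\<lambda>n. CLINT \<omega>|P. iexp (\<Sum>j\<in>?S. t j * W n j \<omega>))
      \<longlonglongrightarrow> (CLINT \<omega>|N. iexp (\<Sum>j\<in>?S. t j * Z j \<omega>))" for t :: "int \<Rightarrow> real"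
  proof -
    let ?Q = "\<Sum>i\<in>?S. \<Sum>j\<in>?S. t i * covariance P (\<lambda>\<omega>. f i (X 1 \<omega>)) (\<lambda>\<omega>. f j (X 1 \<omega>)) * t j"
    have "(CLINT \<omega>|N. iexp (\<Sum>j\<in>?S. t j * Z j \<omega>))
        = exp (\<i> * complex_of_real (\<Sum>j\<in>?S. t j * 0) - complex_of_real ?Q / 2)"
      using Z unfolding normal_vector_def Sigma_nabla_def f_def by blast
    also have "\<dots> = complex_of_real (exp (- ?Q / 2))"
      by (simp add: exp_of_real[symmetric] del: of_real_sum)
    finally have "(CLINT \<omega>|N. iexp (\<Sum>j\<in>?S. t j * Z j \<omega>)) = complex_of_real (exp (- ?Q / 2))" .
    moreover have "\<bar>f j x\<bar> \<le> 2 ^ k" for j x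
      unfolding f_def by (rule nabla_abs_le) (simp add: indicator_def)
    ultimately show ?thesis
      unfolding W_eq using char_tendsto_normal[of ?S f "2 ^ k" t] by simp
  qed
  interpret L: joint_char_convergence P N ?S W Z
    using S(1) W Z_meas char
    by (intro joint_char_convergence.intro joint_char_convergence_axioms.intro P N)

  \<comment> \<open>The gap between \<rho> and the next larger value of the differences, capped at
    1; the inserted 1 keeps the minimum defined when every index is active.\<close>
  define \<delta> where "\<delta> = Min (insert 1 ((\<lambda>j. nabla k (pmf p) j - \<rho>) ` (?S - ?I)))"
  have "\<delta> > 0"
    unfolding \<delta>_def using S \<rho>_le by (subst Min_gr_iff) (auto simp: level_set_def less_le)
  have \<delta>_le: "\<rho> + \<delta> \<le> nabla k (pmf p) j" if "j \<in> ?S - ?I" for j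
  proof -
    have "\<delta> \<le> nabla k (pmf p) j - \<rho>"
      unfolding \<delta>_def using S that by (intro Min_le) auto
    then show ?thesis by simp
  qed

  define T where "T n \<omega> = sqrt (real n) * (emp_min_nabla k X n \<omega> - \<rho>)" for n \<omega>
  define V where "V n \<omega> = Min ((\<lambda>j. W n j \<omega>) ` ?I)" for n \<omega>
  have T_meas [measurable]: "T n \<in> borel_measurable P" for n
  proof -
    note [measurable] = emp_min_nabla_measurable[OF X_measurable, where k = k and n = n]
    show ?thesis unfolding T_def[abs_def] by measurable
  qed
  have V_meas [measurable]: "V n \<in> borel_measurable P" for n
    unfolding V_def[abs_def] using finite_subset[OF I(1) S(1)] by (intro borel_measurable_Min W)

  \<comment> \<open>All randomness is confined to the hypotheses. For a fixed outcome, seeing both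
    endpoints fixes the index set, and the drift beats fluctuations of size \<open>L\<close> once
    sqrt n reaches 2 L / \<delta>.\<close>
  have T_eq_V: "T n \<omega> = V n \<omega>"
    if n: "n \<ge> 1" and supp_X: "\<forall>i\<ge>1. X i \<omega> \<in> {m..M}"
      and ends: "\<exists>i\<in>{1..n}. X i \<omega> = m" "\<exists>i\<in>{1..n}. X i \<omega> = M"
      and small: "\<forall>j\<in>?S. \<bar>W n j \<omega>\<bar> \<le> L" and large: "2 * L / \<delta> \<le> sqrt n" for n \<omega> L
  proof -
    have "emp_index_set k X n \<omega> = ?S"
      using supp_X by (intro emp_index_set_eq ends) simp
    \<comment> \<open>Nonemptiness of \<open>?S\<close> selects the \<open>Min\<close> branch of
      \<open>emp_min_nabla\<close>.\<close>
    then have "T n \<omega> = sqrt n * (Min (nabla k (emp_pmf X n \<omega>) ` ?S) - \<rho>)"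
      using S by (simp add: T_def emp_min_nabla_def)
    also have "\<dots> = V n \<omega>"
      unfolding V_def
    proof (rule scaled_Min_eq_Min_active[OF S(1) I, where r = "nabla k (pmf p)" and \<delta> = \<delta> and L = L])
      show "2 * L \<le> sqrt n * \<delta>"
        using large \<open>\<delta> > 0\<close> by (simp add: divide_le_eq)
      show "sqrt n > 0" using n by simp
      show "W n j \<omega> = sqrt n * (nabla k (emp_pmf X n \<omega>) j - nabla k (pmf p) j)" for j
        by (simp add: W_def)
      show "nabla k (pmf p) j = \<rho>" if "j \<in> ?I" for j
        using that by (simp add: level_set_def)
    qed (use small \<delta>_le in blast)+
    finally show ?thesis .
  qed

  have "(\<lambda>n. prob {\<omega> \<in> space P. T n \<omega> \<noteq> V n \<omega>}) \<longlonglongrightarrow> 0"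
  proof (rule order_tendstoI)
    fix e :: real assume e: "e > 0"
    \<comment> \<open>One third each for a sample missing \<open>m\<close>, a sample missing
      \<open>M\<close>, and a fluctuation above \<open>L\<close>. \<open>L\<close> is chosen before
      n, so sqrt n eventually exceeds 2 L / \<delta>.\<close>
    then have e3: "0 < e/3" by simp
    define A where "A x n = {\<omega> \<in> space P. \<forall>i\<in>{1..n}. X i \<omega> \<noteq> x}" for x n
    obtain L where L: "L > 0" "\<forall>\<^sub>F n in sequentially. prob {\<omega> \<in> space P. \<exists>j\<in>?S. \<bar>W n j \<omega>\<bar> > L} < e/3"
      using L.tight[OF e3] by blast
    have "m \<in> set_pmf p" "M \<in> set_pmf p" using mM supp by auto
    then have A_small: "(\<lambda>n. prob (A m n)) \<longlonglongrightarrow> 0" "(\<lambda>n. prob (A M n)) \<longlonglongrightarrow> 0"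
      unfolding A_def by (simp_all only: prob_never_tendsto_0)
    have "filterlim (\<lambda>n. sqrt (real n)) at_top sequentially"
      by (rule filterlim_compose[OF sqrt_at_top filterlim_real_sequentially])
    then have sqrt_large: "\<forall>\<^sub>F n in sequentially. 2 * L / \<delta> \<le> sqrt n"
      by (simp add: filterlim_at_top)
    show "\<forall>\<^sub>F n in sequentially. prob {\<omega> \<in> space P. T n \<omega> \<noteq> V n \<omega>} < e"
      using L(2) order_tendstoD(2)[OF A_small(1) e3] order_tendstoD(2)[OF A_small(2) e3] sqrt_large
        eventually_ge_at_top[of 1]
    proof eventually_elim
      case (elim n)
      let ?C = "{\<omega> \<in> space P. \<exists>j\<in>?S. \<bar>W n j \<omega>\<bar> > L}"
      have A [measurable]: "A x n \<in> events" for x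
      proof -
        have "A x n = space P \<inter> (\<Inter>i\<in>{1..n}. X i -` (- {x}) \<inter> space P)"
          by (auto simp: A_def)
        also have "\<dots> \<in> events"
          using \<open>1 \<le> n\<close> by (intro sets.Int sets.finite_INT measurable_sets[OF X_measurable]) auto
        finally show ?thesis .
      qed
      have C [measurable]: "?C \<in> events"
      proof -
        have "?C = (\<Union>j\<in>?S. {\<omega> \<in> space P. \<bar>W n j \<omega>\<bar> > L})" by auto
        also have "\<dots> \<in> events" using S by (intro sets.finite_UN) auto
        finally show ?thesis .
      qed
      have "prob {\<omega> \<in> space P. T n \<omega> \<noteq> V n \<omega>} \<le> prob ((A m n \<union> A M n) \<union> ?C)"
      \<comment> \<open>The inclusion is asserted almost surely, because observations are confined
        to the support only off a null set.\<close>
      proof (rule finite_measure_mono_AE)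
        show "AE \<omega> in P. \<omega> \<in> {\<omega> \<in> space P. T n \<omega> \<noteq> V n \<omega>} \<longrightarrow> \<omega> \<in> (A m n \<union> A M n) \<union> ?C"
          using AE_X_in_set_pmf
        proof eventually_elim
          case (elim \<omega>)
          show ?case
          proof (rule impI, rule ccontr)
            assume "\<omega> \<in> {\<omega> \<in> space P. T n \<omega> \<noteq> V n \<omega>}" and "\<omega> \<notin> (A m n \<union> A M n) \<union> ?C"
            then have "T n \<omega> \<noteq> V n \<omega>" "\<exists>i\<in>{1..n}. X i \<omega> = m" "\<exists>i\<in>{1..n}. X i \<omega> = M"
                "\<forall>j\<in>?S. \<bar>W n j \<omega>\<bar> \<le> L"
              unfolding A_def by (simp_all add: not_less)
            then show False
              using T_eq_V[OF \<open>1 \<le> n\<close> elim[unfolded supp] _ _ _ \<open>2 * L / \<delta> \<le> sqrt n\<close>] by blast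
          qed
        qed
      qed (intro sets.Un A C)
      also have "\<dots> \<le> prob (A m n \<union> A M n) + prob ?C"
        by (intro measure_Un_le sets.Un A C)
      finally show ?case
        using elim measure_Un_le[OF A[of m] A[of M]] by linarith
    qed
  next
    fix a :: real assume "a < 0"
    then show "\<forall>\<^sub>F n in sequentially. a < prob {\<omega> \<in> space P. T n \<omega> \<noteq> V n \<omega>}"
      by (intro always_eventually allI less_le_trans[OF _ measure_nonneg])
  qed
  moreover have "weak_conv_m (\<lambda>n. distr P borel (V n)) (distr N borel (\<lambda>\<omega>. Min ((\<lambda>j. Z j \<omega>) ` ?I)))"
    unfolding V_def[abs_def] using I by (rule L.Min_weak_conv)
  ultimately have "weak_conv_m (\<lambda>n. distr P borel (T n)) (distr N borel (\<lambda>\<omega>. Min ((\<lambda>j. Z j \<omega>) ` ?I)))"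
    by (intro weak_conv_m_asymptotically_equal[OF T_meas V_meas])
  then show "weak_conv_m
      (\<lambda>n. distr P borel (\<lambda>\<omega>. sqrt (real n) * (emp_min_nabla k X n \<omega> - \<rho>)))
      (distr N borel (\<lambda>\<omega>. Min ((\<lambda>j. Z j \<omega>) ` ?I)))"
    unfolding T_def[abs_def] .

  assume "\<rho> = 0"
  then have nonneg: "0 \<le> nabla k (pmf p) j" if "j \<in> ?S" for j
    using \<rho>_le[OF that] by simp
  then show "k_monotone k m M (pmf p)"
    unfolding k_monotone_def by blast
  show "level_set k m M (pmf p) 0 = index_set k m M - knots k m M (pmf p)"
    unfolding level_set_def knots_def using nonneg by force
qed

end
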